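(* Let $\mathcal{A}$ be a C*-algebra such that there is an uncountable discrete set of pure states of $\mathcal{A}$. Then there is a UBABS+ of type $\eta$ in $\mathcal{A}$ for some $0\leq\eta<1$.
   Context: The set $P(\mathcal{A})$ of pure states carries the weak*-topology; a subset is discrete if it is discrete in the relative topology. UBABS+ (uncountable positive bounded almost biorthogonal system) of type $\eta$: a bounded family $(a_\alpha,\tau_\alpha)_{\alpha<\omega_1}$ in $\mathcal{A}\times\mathcal{A}^*$ such that for every $\alpha<\omega_1$, $\tau_\alpha$ is a state (positive linear functional of norm one), $a_\alpha$ is a positive element with $0<a_\alpha\leq 1$ (i.e. nonzero, positive, of norm at most one), $\tau_\alpha(a_\alpha)=1$, and $|\tau_\alpha(a_\beta)|\leq\eta$ for all $\beta\neq\alpha$. *)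

theory Defs
  imports "HOL-Analysis.Analysis"
begin

(* C*-algebras are complex, and neither a unit nor 1 \<noteq> 0 is assumed: real_normed_algebra is
   the non-unital class.  The axiom scaleR_eq_scaleC links the complex structure to the real one
   carried by the library classes; with r = 1 it also gives scaleC 1 x = x. *)
class cstar_algebra = real_normed_algebra + banach +
  fixes scaleC :: "complex \<Rightarrow> 'a \<Rightarrow> 'a"  (infixr "*\<^sub>C" 75)
    and star :: "'a \<Rightarrow> 'a"
  assumes scaleC_add_right: "c *\<^sub>C (x + y) = c *\<^sub>C x + c *\<^sub>C y"
    and scaleC_add_left: "(c + d) *\<^sub>C x = c *\<^sub>C x + d *\<^sub>C x"
    and scaleC_scaleC: "c *\<^sub>C (d *\<^sub>C x) = (c * d) *\<^sub>C x"
    and scaleR_eq_scaleC: "r *\<^sub>R x = complex_of_real r *\<^sub>C x"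
    and scaleC_mult_left: "(c *\<^sub>C x) * y = c *\<^sub>C (x * y)"
    and scaleC_mult_right: "x * (c *\<^sub>C y) = c *\<^sub>C (x * y)"
    and norm_scaleC: "norm (c *\<^sub>C x) = cmod c * norm x"
    and star_star: "star (star x) = x"
    and star_add: "star (x + y) = star x + star y"
    and star_scaleC: "star (c *\<^sub>C x) = cnj c *\<^sub>C star x"
    and star_mult: "star (x * y) = star y * star x"
    and norm_star_mult_self: "norm (star x * x) = (norm x)\<^sup>2"

definition cstar_positive :: "'a::cstar_algebra \<Rightarrow> bool"
  where "cstar_positive a \<longleftrightarrow> (\<exists>b. a = star b * b)"

(* Elements of 'a \<Rightarrow>\<^sub>L complex are bounded and only real-linear; this is the subset of the
   complex-linear ones.  The operator norm does not depend on the scalar field. *)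
definition cstar_dual :: "('a::cstar_algebra \<Rightarrow>\<^sub>L complex) set"
  where "cstar_dual = {\<tau>. \<forall>c x. blinfun_apply \<tau> (c *\<^sub>C x) = c * blinfun_apply \<tau> x}"

definition states :: "('a::cstar_algebra \<Rightarrow>\<^sub>L complex) set"
  where "states = {\<tau> \<in> cstar_dual.
    (\<forall>x. cstar_positive x \<longrightarrow> blinfun_apply \<tau> x \<in> \<real>\<^sub>\<ge>\<^sub>0) \<and> norm \<tau> = 1}"

definition pure_states :: "('a::cstar_algebra \<Rightarrow>\<^sub>L complex) set"
  where "pure_states = {\<tau>. \<tau> extreme_point_of states}"

(* The strong operator topology on scalar-valued maps is that of pointwise convergence, so it
   restricts to the weak* topology. *)
definition pure_state_space :: "('a::cstar_algebra \<Rightarrow>\<^sub>L complex) topology"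
  where "pure_state_space = subtopology strong_operator_topology pure_states"

definition discrete_in :: "'b topology \<Rightarrow> 'b set \<Rightarrow> bool"
  where "discrete_in X D \<longleftrightarrow> D \<subseteq> topspace X \<and> subtopology X D = discrete_topology D"

(* A copy of the ordinal \<omega>\<^sub>1: the underlying set of the initial well-order cardSuc natLeq of
   cardinality aleph_1. *)
abbreviation omega1 :: "nat set set"
  where "omega1 \<equiv> Field (cardSuc natLeq)"

definition UBABS_plus ::
    "real \<Rightarrow> (nat set \<Rightarrow> 'a::cstar_algebra) \<Rightarrow> (nat set \<Rightarrow> 'a \<Rightarrow>\<^sub>L complex) \<Rightarrow> bool"
  where "UBABS_plus \<eta> a \<tau> \<longleftrightarrow>
    bounded ((\<lambda>\<alpha>. (a \<alpha>, \<tau> \<alpha>)) ` omega1) \<and>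
    (\<forall>\<alpha>\<in>omega1.
      \<tau> \<alpha> \<in> states \<and>
      cstar_positive (a \<alpha>) \<and> a \<alpha> \<noteq> 0 \<and> norm (a \<alpha>) \<le> 1 \<and>
      blinfun_apply (\<tau> \<alpha>) (a \<alpha>) = 1 \<and>
      (\<forall>\<beta>\<in>omega1. \<beta> \<noteq> \<alpha> \<longrightarrow> cmod (blinfun_apply (\<tau> \<alpha>) (a \<beta>)) \<le> \<eta>))"

end

theory Submission
  imports Defs "HOL-Library.Countable_Set_Type"
begin

text \<open>Write \<open>D\<close> for the uncountable discrete set of pure states. The heart of the proof is a form of
  excision: for every \<open>\<tau> \<in> D\<close> there is a gap \<open>\<gamma> > 0\<close> such that, for each \<open>\<epsilon> > 0\<close>, some
  \<open>0 \<le> a \<le> 1\<close> satisfies \<open>\<tau> a \<ge> 1 - \<epsilon>\<close> but \<open>\<sigma> a \<le> 1 - \<gamma>\<close> for all other \<open>\<sigma> \<in> D\<close>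
  (\<open>excised_with_gap_exists\<close>). The gap does not depend on \<open>\<epsilon>\<close>, and this makes everything else work.
  As \<open>D\<close> is uncountable, one value of \<open>\<gamma>\<close> serves uncountably many \<open>\<tau>\<close>; for these \<open>\<epsilon>\<close> is taken
  tiny compared with \<open>\<gamma>\<close>. Compressing \<open>\<tau>\<close> to the part of the spectrum of \<open>a\<close> near \<open>1\<close> then moves it by
  an amount small in norm to a state \<open>\<tau>'\<close> that takes the value exactly \<open>1\<close> at a truncation \<open>d\<close> of
  \<open>a\<close> (\<open>nearby_state_attaining_one\<close>). The pairs \<open>(d, \<tau>')\<close>, indexed by \<open>omega1\<close>, form the required
  system: its states need not be pure, so replacing \<open>\<tau>\<close> by \<open>\<tau>'\<close> is harmless, and the exact
  excision that would need Kadison's transitivity theorem is avoided.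

  Excision itself comes straight from extremality. Let \<open>\<tau>\<close> be pure and \<open>y\<close> self-adjoint with
  \<open>\<tau> y \<le> 0\<close>. The functional \<open>inf {\<tau> h | h \<ge> 0, h \<ge> y}\<close> is sublinear in \<open>y\<close>, and by the Hahn--Banach
  theorem it is attained at \<open>y\<close> by a functional \<open>\<phi>\<close> with \<open>0 \<le> \<phi> \<le> \<tau>\<close>. Extremality makes \<open>\<phi>\<close> a
  multiple of \<open>\<tau>\<close>, so the infimum is \<open>0\<close> and there are \<open>h \<ge> 0\<close>, \<open>h \<ge> y\<close> with \<open>\<tau> h\<close> arbitrarily small
  (\<open>pure_state_majorant\<close>). The norm of \<open>h\<close> is out of control, but \<open>b = h (\<kappa> + h)\<^sup>-\<^sup>1\<close> is a
  contraction with \<open>\<tau> b \<le> \<tau> h / \<kappa>\<close>, and every state \<open>\<sigma>\<close> satisfies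
  \<open>\<sigma> y \<le> \<kappa> + 2 \<parallel>y\<parallel> sqrt (\<sigma> b)\<close> (\<open>excision_one_element\<close>). Hence states on which \<open>y\<close> is not small have
  \<open>\<sigma> b\<close> bounded below by a constant that depends on \<open>y\<close> alone. A weak* neighbourhood of \<open>\<tau>\<close> involves finitely many
  such \<open>y\<close>, and averaging the corresponding \<open>b\<close> and passing to \<open>1 - b\<close> yields the excising element.

  The order theory of C*-algebras that this uses is developed from the norm alone, without spectra: the
  positive cone, the positivity of \<open>b\<^sup>* b\<close>, resolvents, and positive and negative parts. It is
  carried out in unital algebras and applied to the unitization, to which states extend as positive
  functionals.\<close>

section \<open>Involution and norm\<close>

lemma scaleC_simps [simp]:
  fixes x :: "'a::cstar_algebra"
  shows "1 *\<^sub>C x = x" "0 *\<^sub>C x = 0" "c *\<^sub>C (0::'a) = 0" "(- 1) *\<^sub>C x = - x"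
proof -
  show 1: "1 *\<^sub>C x = x" using scaleR_eq_scaleC[of 1 x] by simp
  show 0: "0 *\<^sub>C x = 0" using scaleR_eq_scaleC[of 0 x] by simp
  show "c *\<^sub>C (0::'a) = 0" using scaleC_add_right[of c 0 "0::'a"] by simp
  show "(- 1) *\<^sub>C x = - x"
    using scaleR_eq_scaleC[of "-1" x] by simp
qed

lemma scaleC_minus_right: "c *\<^sub>C (- x) = - (c *\<^sub>C (x::'a::cstar_algebra))"
  using scaleC_add_right[of c x "-x"] by (simp add: eq_neg_iff_add_eq_0 add.commute)

lemma scaleC_minus_left: "(- c) *\<^sub>C x = - (c *\<^sub>C (x::'a::cstar_algebra))"
  using scaleC_scaleC[of "-1" c x] by simp

lemma scaleC_diff_right: "c *\<^sub>C (x - y) = c *\<^sub>C x - c *\<^sub>C (y::'a::cstar_algebra)"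
  using scaleC_add_right[of c x "-y"] by (simp add: scaleC_minus_right)

lemma scaleC_diff_left: "(c - d) *\<^sub>C x = c *\<^sub>C x - d *\<^sub>C (x::'a::cstar_algebra)"
  using scaleC_add_left[of c "-d" x] by (simp add: scaleC_minus_left)

lemma star_0 [simp]: "star (0::'a::cstar_algebra) = 0"
  using star_scaleC[of 0 "0::'a"] by simp

lemma star_minus: "star (- x) = - star (x::'a::cstar_algebra)"
  using star_scaleC[of "-1" x] by simp

lemma star_diff: "star (x - y) = star x - star (y::'a::cstar_algebra)"
  using star_add[of x "-y"] by (simp add: star_minus)

lemma star_scaleR: "star (r *\<^sub>R x) = r *\<^sub>R star (x::'a::cstar_algebra)"
  by (simp add: scaleR_eq_scaleC star_scaleC)

lemmas star_simps = star_star star_add star_diff star_minus star_scaleC star_scaleR star_mult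

lemma norm_star [simp]: "norm (star x) = norm (x::'a::cstar_algebra)"
proof -
  have le: "norm y \<le> norm (star y)" for y :: 'a
  proof (cases "y = 0")
    case False
    have "norm y * norm y \<le> norm (star y) * norm y"
      using norm_star_mult_self[of y] norm_mult_ineq[of "star y" y] by (simp add: power2_eq_square)
    then show ?thesis using False by simp
  qed simp
  show ?thesis using le[of x] le[of "star x"] by (simp add: star_star)
qed

lemma norm_self_mult_star: "norm (x * star x) = (norm (x::'a::cstar_algebra))\<^sup>2"
  using norm_star_mult_self[of "star x"] by (simp add: star_star)

lemma bounded_linear_star: "bounded_linear (star :: 'a::cstar_algebra \<Rightarrow> 'a)"
  by (rule bounded_linear_intro[where K=1]) (simp_all add: star_simps)

lemma star_mult_self_eq_0: "star x * x = 0 \<longleftrightarrow> (x::'a::cstar_algebra) = 0"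
  using norm_star_mult_self[of x] by (metis mult_zero_right norm_eq_zero power_eq_0_iff zero_neq_numeral)

lemma sa_square_eq_0: "star x = x \<Longrightarrow> x * x = 0 \<Longrightarrow> (x::'a::cstar_algebra) = 0"
  using star_mult_self_eq_0[of x] by simp

lemma norm_sa_square: "star x = x \<Longrightarrow> norm (x * x) = (norm (x::'a::cstar_algebra))\<^sup>2"
  using norm_star_mult_self[of x] by simp

section \<open>Square roots\<close>

text \<open>Unital algebras are given by the sort \<open>{cstar_algebra, monoid_mult}\<close>, so that the zero
  algebra is included and only \<open>\<parallel>1\<parallel> \<le> 1\<close> is available.\<close>
lemma star_1 [simp]: "star (1::'a::{cstar_algebra,monoid_mult}) = 1"
  by (metis mult.right_neutral star_mult star_star)

lemma norm_1_le: "norm (1::'a::{cstar_algebra,monoid_mult}) \<le> 1"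
proof -
  have "norm (1::'a) = norm (1::'a) * norm (1::'a)"
    using norm_star_mult_self[of "1::'a"] by (simp add: power2_eq_square)
  then show ?thesis by (metis mult_cancel_left2 order_refl zero_le_one)
qed

lemma norm_scaleR_1_le: "norm (t *\<^sub>R (1::'a::{cstar_algebra,monoid_mult})) \<le> \<bar>t\<bar>"
  using norm_1_le mult_left_le[OF norm_1_le, of "\<bar>t\<bar>"] by simp

text \<open>The iteration \<open>s \<mapsto> (x + s\<^sup>2) / 2\<close> from \<open>0\<close> has the fixed point \<open>1 - sqrt (1 - x)\<close>. Its iterates are
  polynomials in \<open>x\<close> with nonnegative coefficients, so for \<open>\<parallel>x\<parallel> \<le> 1\<close> its increments are dominated by
  those of the scalar iteration with \<open>x = 1\<close>, which increases and is bounded by \<open>1\<close>.\<close>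
lemma sqrt_one_minus:
  fixes x :: "'a::{cstar_algebra,monoid_mult}"
  assumes sa: "star x = x" and nx: "norm x \<le> 1"
  obtains s where "star s = s" "norm s \<le> 1" "(1 - s) * (1 - s) = 1 - x"
    "\<And>z. z * x = x * z \<Longrightarrow> z * s = s * z"
proof -
  define S where "S = rec_nat 0 (\<lambda>_ p. (1/2) *\<^sub>R (x + p * p))"
  define r where "r = rec_nat (0::real) (\<lambda>_ q. (1 + q * q) / 2)"
  have S0: "S 0 = 0" and SS: "S (Suc n) = (1/2) *\<^sub>R (x + S n * S n)" for n
    by (simp_all add: S_def)
  have r0: "r 0 = 0" and rS: "r (Suc n) = (1 + r n * r n) / 2" for n
    by (simp_all add: r_def)
  have rb: "0 \<le> r n \<and> r n \<le> 1" for n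
  proof (induction n)
    case (Suc n)
    then have "r n * r n \<le> 1" by (simp add: mult_le_one)
    then show ?case by (simp add: rS)
  qed (simp add: r0)
  have rinc: "r n \<le> r (Suc n)" for n
  proof -
    have "0 \<le> (1 - r n) * (1 - r n)" by simp
    then show ?thesis by (simp add: rS algebra_simps)
  qed
  have comm: "z * S n = S n * z" if "z * x = x * z" for z n
  proof (induction n)
    case (Suc n)
    have "z * (S n * S n) = (S n * S n) * z" using Suc by (metis mult.assoc)
    then show ?case using that by (simp add: SS algebra_simps)
  qed (simp add: S0)
  have xS: "S n * x = x * S n" for n using comm[of x n] by simp
  have SScomm: "S m * S n = S n * S m" for m n using comm[OF xS] .
  have Sn: "norm (S n) \<le> r n" for n
  proof (induction n)
    case (Suc n)
    have "norm (x + S n * S n) \<le> 1 + r n * r n"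
      using nx norm_mult_ineq[of "S n" "S n"] mult_mono[OF Suc Suc] rb[of n] norm_triangle_ineq[of x "S n * S n"]
      by auto
    then show ?case by (simp add: SS rS)
  qed (simp add: S0 r0)
  have Sdiff: "norm (S (Suc n) - S n) \<le> r (Suc n) - r n" for n
  proof (induction n)
    case 0
    then show ?case using nx by (simp add: SS S0 rS r0)
  next
    case (Suc n)
    have "S (Suc (Suc n)) - S (Suc n) = (1/2) *\<^sub>R (S (Suc n) * S (Suc n) - S n * S n)"
      unfolding SS[of "Suc n"] by (subst (3) SS) (simp add: algebra_simps)
    moreover have "S (Suc n) * S (Suc n) - S n * S n = (S (Suc n) - S n) * (S (Suc n) + S n)"
      using SScomm[of n "Suc n"] by (simp add: algebra_simps)
    ultimately have eq: "S (Suc (Suc n)) - S (Suc n) = (1/2) *\<^sub>R ((S (Suc n) - S n) * (S (Suc n) + S n))"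
      by simp
    have "norm ((S (Suc n) - S n) * (S (Suc n) + S n)) \<le> (r (Suc n) - r n) * (r (Suc n) + r n)"
    proof (rule order_trans[OF norm_mult_ineq], rule mult_mono[OF Suc])
      show "norm (S (Suc n) + S n) \<le> r (Suc n) + r n"
        using norm_triangle_ineq[of "S (Suc n)" "S n"] Sn[of n] Sn[of "Suc n"] by linarith
    qed (use rinc[of n] in auto)
    then have "norm (S (Suc (Suc n)) - S (Suc n)) \<le> (r (Suc n) - r n) * (r (Suc n) + r n) / 2"
      unfolding eq by simp
    also have "\<dots> = r (Suc (Suc n)) - r (Suc n)"
      by (simp add: rS[of "Suc n"] rS[of n] field_simps)
    finally show ?case .
  qed
  have Sd: "norm (S (n + k) - S n) \<le> r (n + k) - r n" for n k
  proof (induction k)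
    case (Suc k)
    have "norm (S (n + Suc k) - S n) \<le> norm (S (Suc (n + k)) - S (n + k)) + norm (S (n + k) - S n)"
      using norm_triangle_ineq[of "S (Suc (n + k)) - S (n + k)" "S (n + k) - S n"] by simp
    then show ?case using Suc Sdiff[of "n + k"] by simp
  qed simp
  have "convergent r"
  proof (rule Bseq_monoseq_convergent)
    show "Bseq r" using rb by (intro BseqI'[where K=1]) (simp add: abs_of_nonneg)
    show "monoseq r" using rinc by (simp add: monoseq_Suc) 
  qed
  then have "Cauchy r" by (simp add: convergent_Cauchy)
  have "Cauchy S"
  proof (rule metric_CauchyI)
    fix e :: real assume "0 < e"
    then obtain M where M: "\<And>m n. m \<ge> M \<Longrightarrow> n \<ge> M \<Longrightarrow> dist (r m) (r n) < e"
      using \<open>Cauchy r\<close> by (meson metric_CauchyD)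
    have *: "dist (S m) (S n) < e" if "m \<ge> M" "n \<ge> m" for m n
      using Sd[of m "n - m"] M[of n m] that by (simp add: dist_norm norm_minus_commute)
    show "\<exists>M. \<forall>m\<ge>M. \<forall>n\<ge>M. dist (S m) (S n) < e"
      using * by (metis dist_commute nle_le)
  qed
  then obtain s where s: "S \<longlonglongrightarrow> s" using Cauchy_convergent convergent_def by blast
  have Ssa: "star (S n) = S n" for n
    by (induction n) (simp_all add: S0 SS star_simps sa)
  have 1: "star s = s"
    using LIMSEQ_unique[OF bounded_linear.tendsto[OF bounded_linear_star s]] s Ssa by simp
  have 2: "norm s \<le> 1"
    by (rule LIMSEQ_le_const2[OF tendsto_norm[OF s]]) (meson Sn rb order_trans)
  have "(\<lambda>n. S (Suc n)) \<longlonglongrightarrow> (1/2) *\<^sub>R (x + s * s)"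
    unfolding SS by (intro tendsto_intros s)
  then have "s = (1/2) *\<^sub>R (x + s * s)" by (rule LIMSEQ_unique[OF LIMSEQ_Suc[OF s]])
  then have "2 *\<^sub>R s = 2 *\<^sub>R ((1/2) *\<^sub>R (x + s * s))" by (rule arg_cong)
  then have "2 *\<^sub>R s = x + s * s" unfolding scaleR_scaleR by simp
  then have 3: "(1 - s) * (1 - s) = 1 - x" by (simp add: algebra_simps scaleR_2)
  have 4: "z * s = s * z" if "z * x = x * z" for z
  proof (rule LIMSEQ_unique)
    show "(\<lambda>n. z * S n) \<longlonglongrightarrow> z * s" by (intro tendsto_intros s)
    show "(\<lambda>n. z * S n) \<longlonglongrightarrow> s * z" unfolding comm[OF that] by (intro tendsto_intros s)
  qed
  show thesis by (rule that[OF 1 2 3 4])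
qed

section \<open>The positive cone\<close>

text \<open>A spectrum-free form of positivity: the condition says that the spectrum of the self-adjoint element
  \<open>h\<close> lies in \<open>[0, 2 t]\<close>. In this form the sum of two positive elements is visibly positive, while
  the agreement with squares (\<open>pos_sqrt\<close>) and with the elements \<open>b\<^sup>* b\<close> (\<open>pos_star_mult\<close>) has to be proved.\<close>
definition pos :: "'a::{cstar_algebra,monoid_mult} \<Rightarrow> bool"
  where "pos h \<longleftrightarrow> star h = h \<and> (\<exists>t\<ge>0. norm (t *\<^sub>R 1 - h) \<le> t)"

lemma pos_sa: "pos h \<Longrightarrow> star h = h"
  by (simp add: pos_def)

text \<open>The element \<open>y + i w\<close> is unitary and has \<open>y\<close> and \<open>w\<close> as its real and imaginary parts. This is the
  source of all norm bounds that would otherwise be read off from the spectrum.\<close>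
lemma unitary_from_square:
  fixes y w :: "'a::{cstar_algebra,monoid_mult}"
  assumes "star y = y" "star w = w" "y * w = w * y" "y * y + w * w = 1"
  shows "norm y \<le> 1" "norm w \<le> 1"
proof -
  define u where "u = y + \<i> *\<^sub>C w"
  have su: "star u = y - \<i> *\<^sub>C w"
    using assms by (simp add: u_def star_simps scaleC_minus_left)
  have "star u * u = y * y + w * w"
    unfolding su unfolding u_def
    using assms(3) by (simp add: algebra_simps scaleC_mult_left scaleC_mult_right scaleC_scaleC scaleC_diff_right)
  then have "(norm u)\<^sup>2 = norm (1::'a)"
    using norm_star_mult_self[of u] assms(4) by simp
  also have "\<dots> \<le> 1\<^sup>2" using norm_1_le by simp
  finally have nu: "norm u \<le> 1" by (rule power2_le_imp_le) simp
  have nsu: "norm (star u) \<le> 1" using nu by simp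
  have "2 *\<^sub>R y = u + star u" unfolding su by (simp add: u_def scaleR_2)
  then have "2 * norm y \<le> norm u + norm (star u)"
    using norm_triangle_ineq[of u "star u"] by (metis abs_numeral norm_scaleR)
  then show "norm y \<le> 1" using nu nsu by linarith
  have "(2 * \<i>) *\<^sub>C w = u - star u"
    unfolding su using scaleC_add_left[of \<i> \<i> w] by (simp add: u_def)
  then have "2 * norm w \<le> norm u + norm (star u)"
    using norm_triangle_ineq4[of u "star u"] norm_scaleC[of "2 * \<i>" w] by (simp add: norm_mult)
  then show "norm w \<le> 1" using nu nsu by linarith
qed

text \<open>With \<open>w = sqrt (1 - y\<^sup>2)\<close> the element \<open>y + i w\<close> is unitary, whence \<open>\<parallel>w\<parallel> \<le> 1\<close> and \<open>\<parallel>1 - y\<^sup>2\<parallel> = \<parallel>w\<parallel>\<^sup>2\<close>.\<close>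
lemma norm_one_minus_square:
  fixes y :: "'a::{cstar_algebra,monoid_mult}"
  assumes sa: "star y = y" and ny: "norm y \<le> 1"
  shows "norm (1 - y * y) \<le> 1"
proof -
  have "star (y * y) = y * y" "norm (y * y) \<le> 1"
    using assms by (simp_all add: star_mult norm_sa_square power_le_one)
  then obtain s where s: "star s = s" "(1 - s) * (1 - s) = 1 - y * y"
      and c: "\<And>z. z * (y * y) = (y * y) * z \<Longrightarrow> z * s = s * z"
    by (rule sqrt_one_minus) blast
  have sw: "star (1 - s) = 1 - s" using s by (simp add: star_simps)
  have "y * s = s * y" by (rule c) (simp add: mult.assoc)
  then have "norm (1 - s) \<le> 1"
    using s sw by (intro unitary_from_square(2)[of y "1 - s"]) (simp_all add: sa algebra_simps)
  then show ?thesis using norm_sa_square[OF sw] s by (simp add: power_le_one)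
qed

lemma norm_scaled_one_minus_square:
  fixes y :: "'a::{cstar_algebra,monoid_mult}"
  assumes sa: "star y = y" and t: "0 \<le> t" "norm y \<le> t"
  shows "norm (t\<^sup>2 *\<^sub>R 1 - y * y) \<le> t\<^sup>2"
proof (cases "t = 0")
  case False
  define z where "z = (1 / t) *\<^sub>R y"
  have "star z = z" "norm z \<le> 1" using False t by (simp_all add: z_def star_simps sa field_simps)
  then have n: "norm (1 - z * z) \<le> 1" by (rule norm_one_minus_square)
  have "t\<^sup>2 *\<^sub>R 1 - y * y = t\<^sup>2 *\<^sub>R (1 - z * z)"
    using False by (simp add: z_def scaleR_diff_right power2_eq_square)
  then show ?thesis using n by (simp add: mult_left_le)
qed (use t in simp)

lemma pos_squareI:
  fixes y :: "'a::{cstar_algebra,monoid_mult}"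
  assumes "star y = y" shows "pos (y * y)"
  unfolding pos_def using assms norm_scaled_one_minus_square[OF assms, of "norm y"]
  by (auto simp: star_mult intro!: exI[of _ "(norm y)\<^sup>2"])

lemma norm_scaled_one_diff_mono:
  fixes h :: "'a::{cstar_algebra,monoid_mult}"
  assumes "norm (t *\<^sub>R 1 - h) \<le> t" "t \<le> t'"
  shows "norm (t' *\<^sub>R 1 - h) \<le> t'"
proof -
  have "t' *\<^sub>R 1 - h = (t *\<^sub>R 1 - h) + (t' - t) *\<^sub>R 1" by (simp add: algebra_simps)
  then have "norm (t' *\<^sub>R 1 - h) \<le> norm (t *\<^sub>R 1 - h) + norm ((t' - t) *\<^sub>R (1::'a))"
    by (metis norm_triangle_ineq)
  then show ?thesis using assms norm_scaleR_1_le[of "t' - t", where 'a='a] by linarith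
qed

text \<open>If \<open>\<parallel>t - h\<parallel> \<le> t\<close>, then \<open>h = t (1 - x)\<close> with \<open>\<parallel>x\<parallel> \<le> 1\<close>, and \<open>1 - x\<close> has a square root.\<close>
lemma pos_sqrt:
  fixes h :: "'a::{cstar_algebra,monoid_mult}"
  assumes "pos h"
  obtains y where "pos y" "star y = y" "y * y = h" "\<And>z. z * h = h * z \<Longrightarrow> z * y = y * z"
proof -
  obtain t0 where sa: "star h = h" and "t0 \<ge> 0" "norm (t0 *\<^sub>R 1 - h) \<le> t0"
    using assms by (auto simp: pos_def)
  define t where "t = t0 + 1"
  have t: "t > 0" "norm (t *\<^sub>R 1 - h) \<le> t"
    using \<open>t0 \<ge> 0\<close> norm_scaled_one_diff_mono[OF \<open>norm (t0 *\<^sub>R 1 - h) \<le> t0\<close>, of t] by (auto simp: t_def)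
  define x where "x = 1 - (1/t) *\<^sub>R h"
  have sx: "star x = x" by (simp add: x_def star_simps sa)
  have "x = (1/t) *\<^sub>R (t *\<^sub>R 1 - h)" using t by (simp add: x_def scaleR_diff_right)
  then have "norm x = norm (t *\<^sub>R 1 - h) / t" using t by simp
  then have "norm x \<le> 1" using t by simp
  with sx obtain s where s: "star s = s" "norm s \<le> 1" "(1 - s) * (1 - s) = 1 - x"
      and c: "\<And>z. z * x = x * z \<Longrightarrow> z * s = s * z"
    by (rule sqrt_one_minus) blast
  define y where "y = sqrt t *\<^sub>R (1 - s)"
  have sy: "star y = y" by (simp add: y_def star_simps s)
  have "sqrt t *\<^sub>R 1 - y = sqrt t *\<^sub>R s" by (simp add: y_def algebra_simps)
  then have "norm (sqrt t *\<^sub>R 1 - y) \<le> sqrt t" using s t by (simp add: mult_left_le)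
  then have p: "pos y" using sy t unfolding pos_def by (auto intro: exI[of _ "sqrt t"])
  have "y * y = t *\<^sub>R ((1 - s) * (1 - s))" using t by (simp add: y_def)
  also have "\<dots> = h" using s t by (simp add: x_def)
  finally have yy: "y * y = h" .
  have "z * y = y * z" if "z * h = h * z" for z
  proof -
    have "z * s = s * z" by (rule c) (simp add: x_def algebra_simps that)
    then show ?thesis by (simp add: y_def algebra_simps)
  qed
  then show thesis using that p sy yy by blast
qed

lemma norm_diff_of_pos:
  fixes h :: "'a::{cstar_algebra,monoid_mult}"
  assumes "pos h" "norm h \<le> t"
  shows "norm (t *\<^sub>R 1 - h) \<le> t"
proof -
  obtain y where y: "star y = y" "y * y = h" using pos_sqrt[OF assms(1)] by metis
  have "0 \<le> t" using assms(2) norm_ge_zero[of h] by linarith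
  have "norm y \<le> sqrt t" using assms(2) norm_sa_square[OF y(1)] y(2) by (simp add: real_le_rsqrt)
  then show ?thesis using norm_scaled_one_minus_square[OF y(1), of "sqrt t"] y(2) \<open>0 \<le> t\<close> by simp
qed

lemma pos_0 [simp]: "pos (0::'a::{cstar_algebra,monoid_mult})"
  unfolding pos_def by (auto intro: exI[of _ 0])

lemma pos_add:
  fixes h k :: "'a::{cstar_algebra,monoid_mult}"
  assumes "pos h" "pos k" shows "pos (h + k)"
proof -
  obtain s t where *: "0 \<le> s" "norm (s *\<^sub>R 1 - h) \<le> s" "0 \<le> t" "norm (t *\<^sub>R 1 - k) \<le> t"
    using assms by (auto simp: pos_def)
  have "(s + t) *\<^sub>R 1 - (h + k) = (s *\<^sub>R 1 - h) + (t *\<^sub>R 1 - k)" by (simp add: algebra_simps)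
  then have "norm ((s + t) *\<^sub>R 1 - (h + k)) \<le> s + t"
    using * by (metis add_mono norm_triangle_ineq order_trans)
  then show ?thesis using * assms unfolding pos_def
    by (auto simp: star_simps intro: exI[of _ "s + t"])
qed

lemma pos_scaleR:
  fixes h :: "'a::{cstar_algebra,monoid_mult}"
  assumes "pos h" "0 \<le> c" shows "pos (c *\<^sub>R h)"
proof -
  obtain t where *: "0 \<le> t" "norm (t *\<^sub>R 1 - h) \<le> t" using assms by (auto simp: pos_def)
  have "(c * t) *\<^sub>R 1 - c *\<^sub>R h = c *\<^sub>R (t *\<^sub>R 1 - h)" by (simp add: algebra_simps)
  then have "norm ((c * t) *\<^sub>R 1 - c *\<^sub>R h) \<le> c * t" using * assms by (simp add: mult_left_mono)
  then show ?thesis using * assms unfolding pos_def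
    by (auto simp: star_simps intro: exI[of _ "c * t"])
qed

lemma pos_1 [simp]: "pos (1::'a::{cstar_algebra,monoid_mult})"
  using pos_squareI[of "1::'a"] by simp

lemma pos_sum: "finite I \<Longrightarrow> (\<And>i. i \<in> I \<Longrightarrow> pos (f i)) \<Longrightarrow> pos (\<Sum>i\<in>I. f i)"
  by (induction I rule: finite_induct) (auto intro: pos_add)

lemma pos_norm_diff:
  fixes h :: "'a::{cstar_algebra,monoid_mult}"
  assumes "star h = h" "norm h \<le> t"
  shows "pos (t *\<^sub>R 1 - h)"
proof -
  have "0 \<le> t" using assms(2) norm_ge_zero[of h] by linarith
  then show ?thesis using assms unfolding pos_def
    by (auto simp: star_simps intro!: exI[of _ t])
qed

text \<open>If \<open>h = y\<^sup>2\<close> and \<open>- h = w\<^sup>2\<close> with commuting roots, then \<open>u = y + i w\<close> satisfies \<open>u\<^sup>* u = y\<^sup>2 + w\<^sup>2 = 0\<close>.\<close>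
lemma pos_antisym:
  fixes h :: "'a::{cstar_algebra,monoid_mult}"
  assumes "pos h" "pos (- h)" shows "h = 0"
proof -
  obtain y where y: "star y = y" "y * y = h" "\<And>z. z * h = h * z \<Longrightarrow> z * y = y * z"
    using pos_sqrt[OF assms(1)] by metis
  obtain w where w: "star w = w" "w * w = - h" "\<And>z. z * (-h) = (-h) * z \<Longrightarrow> z * w = w * z"
    using pos_sqrt[OF assms(2)] by metis
  have "y * h = h * y" using y(2) by (metis mult.assoc)
  then have yw: "y * w = w * y" by (intro w(3)) simp
  define u where "u = y + \<i> *\<^sub>C w"
  have su: "star u = y - \<i> *\<^sub>C w"
    using y(1) w(1) by (simp add: u_def star_simps scaleC_minus_left)
  have "star u * u = y * y + w * w"
    unfolding su unfolding u_def
    using yw by (simp add: algebra_simps scaleC_mult_left scaleC_mult_right scaleC_scaleC scaleC_diff_right)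
  then have "u = 0" using y(2) w(2) star_mult_self_eq_0[of u] by simp
  then have "2 *\<^sub>R y = 0" using su by (simp add: u_def scaleR_2)
  then show ?thesis using y(2) by auto
qed

lemma pos_commute_mult:
  fixes h k :: "'a::{cstar_algebra,monoid_mult}"
  assumes "pos h" "pos k" "h * k = k * h" shows "pos (h * k)"
proof -
  obtain y where y: "star y = y" "y * y = h" "\<And>z. z * h = h * z \<Longrightarrow> z * y = y * z"
    using pos_sqrt[OF assms(1)] by metis
  obtain w where w: "star w = w" "w * w = k" "\<And>z. z * k = k * z \<Longrightarrow> z * w = w * z"
    using pos_sqrt[OF assms(2)] by metis
  have "k * y = y * k" using assms(3) by (intro y(3)) simp
  then have yw: "y * w = w * y" by (intro w(3)) simp
  then have "(y * w) * (y * w) = h * k" "star (y * w) = y * w"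
    using y(1,2) w(1,2) by (metis mult.assoc, metis star_mult)
  then show ?thesis using pos_squareI[of "y * w"] by simp
qed

text \<open>For \<open>M = 1\<close> the roots \<open>y\<close> of \<open>p\<close> and \<open>w\<close> of \<open>1 - p\<close> commute and \<open>y + i w\<close> is unitary, so
  \<open>\<parallel>p\<parallel> = \<parallel>y\<parallel>\<^sup>2 \<le> 1\<close>.\<close>
lemma norm_le_of_pos_diff:
  fixes p :: "'a::{cstar_algebra,monoid_mult}"
  assumes "pos p" "pos (M *\<^sub>R 1 - p)" "0 \<le> M"
  shows "norm p \<le> M"
proof (cases "M = 0")
  case True
  then show ?thesis using assms pos_antisym[of p] by simp
next
  case False
  then have M: "M > 0" using assms by simp
  define q where "q = (1/M) *\<^sub>R p"
  have q: "pos q" using assms M by (simp add: q_def pos_scaleR)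
  have "1 - q = (1/M) *\<^sub>R (M *\<^sub>R 1 - p)" using M by (simp add: q_def scaleR_diff_right)
  then have q1: "pos (1 - q)" using assms M by (simp add: pos_scaleR)
  obtain y where y: "star y = y" "y * y = q" "\<And>z. z * q = q * z \<Longrightarrow> z * y = y * z"
    using pos_sqrt[OF q] by metis
  obtain w where w: "star w = w" "w * w = 1 - q" "\<And>z. z * (1 - q) = (1 - q) * z \<Longrightarrow> z * w = w * z"
    using pos_sqrt[OF q1] by metis
  have "y * q = q * y" using y(2) by (metis mult.assoc)
  then have yw: "y * w = w * y" by (intro w(3)) (simp add: algebra_simps)
  have "norm y \<le> 1" using unitary_from_square(1)[OF y(1) w(1) yw] y(2) w(2) by simp
  then have "norm q \<le> 1" using norm_sa_square[OF y(1)] y(2) by (simp add: power_le_one)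
  then show ?thesis using M by (simp add: q_def field_simps)
qed

lemma norm_mono_pos:
  fixes p :: "'a::{cstar_algebra,monoid_mult}"
  assumes "pos p" "pos (q - p)"
  shows "norm p \<le> norm q"
proof (rule norm_le_of_pos_diff[OF assms(1)])
  have "star q = q" using assms by (metis diff_add_cancel pos_sa star_add)
  then have "pos ((norm q *\<^sub>R 1 - q) + (q - p))"
    using assms by (intro pos_add pos_norm_diff) auto
  then show "pos (norm q *\<^sub>R 1 - p)" by simp
qed simp

text \<open>Exponential growth of \<open>(\<rho> / t)\<^sup>N\<close> beats the linear factor \<open>N\<close>. Only powers of two are available
  because the norm of a power is computed by repeated squaring.\<close>
lemma bounded_by_power_imp_le:
  fixes \<rho> t K :: real
  assumes t: "t > 0" and rho: "\<rho> \<ge> 0"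
    and le: "\<And>n. \<rho> ^ (2 ^ n) \<le> t ^ (2 ^ n) + K * real (2 ^ n) * t ^ (2 ^ n - 1)"
  shows "\<rho> \<le> t"
proof (rule ccontr)
  assume "\<not> \<rho> \<le> t"
  define r where "r = \<rho> / t"
  have r: "r > 1" using \<open>\<not> \<rho> \<le> t\<close> t by (simp add: r_def)
  have le2: "r ^ N \<le> 1 + (K/t) * real N" if "N = 2 ^ n" for N n
  proof -
    have "N > 0" using that by simp
    then have "t ^ N = t * t ^ (N - 1)" by (cases N) auto
    then have "\<rho> ^ N \<le> t ^ N * (1 + (K/t) * real N)"
      using le[of n] t that by (simp add: algebra_simps)
    then show ?thesis using t by (simp add: r_def power_divide field_simps)
  qed
  have "(\<lambda>N. real N / r ^ N) \<longlonglongrightarrow> 0"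
    using powser_times_n_limit_0[of "1 / r"] r by (simp add: power_divide)
  moreover have "(\<lambda>N. 1 / r ^ N) \<longlonglongrightarrow> 0"
    using LIMSEQ_inverse_realpow_zero[OF r] by (simp add: inverse_eq_divide)
  ultimately have "(\<lambda>N. 1 / r ^ N + (K/t) * (real N / r ^ N)) \<longlonglongrightarrow> 0 + (K/t) * 0"
    by (intro tendsto_intros)
  then have "\<forall>\<^sub>F N in sequentially. 1 / r ^ N + (K/t) * (real N / r ^ N) < 1"
    by (intro order_tendstoD(2)) auto
  then obtain N0 where N0: "\<And>N. N \<ge> N0 \<Longrightarrow> 1 / r ^ N + (K/t) * (real N / r ^ N) < 1"
    by (auto simp: eventually_sequentially)
  have "(2::nat) ^ N0 \<ge> N0" by (simp add: self_le_power less_imp_le)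
  from N0[OF this] have "1 + (K/t) * real (2 ^ N0) < r ^ (2 ^ N0)"
    using r by (simp add: field_simps del: of_nat_power)
  then show False using le2[OF refl, of N0] by simp
qed

lemma norm_sa_power_two_power:
  fixes z :: "'a::{cstar_algebra,monoid_mult}"
  assumes "star z = z" shows "norm (z ^ (2 ^ n)) = norm z ^ (2 ^ n)"
proof (induction n)
  case (Suc n)
  have star_pow: "star (z ^ m) = z ^ m" for m
    by (induction m) (simp_all add: star_mult assms power_commutes)
  have "z ^ (2 ^ Suc n) = z ^ (2 ^ n) * z ^ (2 ^ n)" by (simp add: mult_2 power_add)
  then show ?case
    using norm_sa_square[OF star_pow[of "2 ^ n"]] Suc by (simp add: power_mult[symmetric] mult.commute)
qed simp

text \<open>A substitute for the fact that \<open>c\<^sup>* c\<close> and \<open>c c\<^sup>*\<close> have the same nonzero spectrum. For \<open>z = t + c\<^sup>* c\<close>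
  and \<open>z' = t + c c\<^sup>*\<close> one has \<open>z' c = c z\<close>, so \<open>z'\<^sup>N = t\<^sup>N + c q c\<^sup>*\<close> where \<open>q\<close> is the sum of the
  \<open>t\<^sup>k z\<^sup>l\<close> over \<open>k + l = N - 1\<close>. If \<open>\<parallel>z\<parallel> \<le> t\<close>, this gives \<open>\<parallel>z'\<parallel>\<^sup>N \<le> t\<^sup>N + N \<parallel>c\<parallel>\<^sup>2 t\<^sup>N\<^sup>-\<^sup>1\<close>, and letting \<open>N\<close> grow
  through the powers of two forces \<open>\<parallel>z'\<parallel> \<le> t\<close>.\<close>
lemma neg_star_mult_swap:
  fixes c :: "'a::{cstar_algebra,monoid_mult}"
  assumes "pos (- (star c * c))"
  shows "pos (- (c * star c))"
proof -
  define t where "t = norm (star c * c) + 1"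
  have t: "t > 0" unfolding t_def using norm_ge_zero[of "star c * c"] by linarith
  define z z' where "z = t *\<^sub>R 1 + star c * c" and "z' = t *\<^sub>R 1 + c * star c"
  have nz: "norm z \<le> t"
    using norm_diff_of_pos[OF assms, of t] by (simp add: z_def t_def)
  define q where "q = rec_nat (0::'a) (\<lambda>n a. t ^ n *\<^sub>R 1 + z * a)"
  have q0: "q 0 = 0" and qS: "q (Suc n) = t ^ n *\<^sub>R 1 + z * q n" for n by (simp_all add: q_def)
  have zc: "z' * c = c * z" by (simp add: z_def z'_def algebra_simps)
  have pow: "z' ^ n = t ^ n *\<^sub>R 1 + c * q n * star c" for n
  proof (induction n)
    case (Suc n)
    have "z' ^ Suc n = t ^ n *\<^sub>R z' + (z' * c) * q n * star c"
      using Suc by (simp add: distrib_left mult.assoc)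
    also have "\<dots> = t ^ Suc n *\<^sub>R 1 + c * q (Suc n) * star c"
      unfolding zc qS by (simp add: z'_def algebra_simps)
    finally show ?case .
  qed (simp add: q0)
  have nq: "norm (q n) \<le> real n * t ^ (n - 1)" for n
  proof (induction n)
    case (Suc n)
    have "norm (q (Suc n)) \<le> t ^ n + norm z * norm (q n)"
      unfolding qS
      by (intro order_trans[OF norm_triangle_ineq] add_mono norm_mult_ineq)
         (use norm_scaleR_1_le[of "t ^ n", where 'a='a] t in auto)
    also have "\<dots> \<le> t ^ n + t * (real n * t ^ (n - 1))"
      using Suc nz t by (intro add_mono mult_mono) auto
    also have "\<dots> = real (Suc n) * t ^ (Suc n - 1)"
      by (cases n) (auto simp: algebra_simps)
    finally show ?case .
  qed (simp add: q0)
  have sz': "star z' = z'" by (simp add: z'_def star_simps)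
  have "norm z' \<le> t"
  proof (rule bounded_by_power_imp_le[OF t, where K = "norm c * norm c"])
    fix n
    let ?N = "2 ^ n :: nat"
    have "norm (c * q ?N * star c) \<le> norm c * norm (q ?N) * norm c"
      by (rule order_trans[OF norm_mult_ineq]) (simp add: mult_right_mono norm_mult_ineq)
    also have "\<dots> \<le> norm c * (real ?N * t ^ (?N - 1)) * norm c"
      by (intro mult_mono nq) (use t in auto)
    moreover have "norm (t ^ ?N *\<^sub>R (1::'a)) \<le> t ^ ?N"
      using norm_scaleR_1_le[of "t ^ ?N", where 'a='a] t by simp
    moreover have "norm (z' ^ ?N) \<le> norm (t ^ ?N *\<^sub>R (1::'a)) + norm (c * q ?N * star c)"
      unfolding pow by (rule norm_triangle_ineq)
    ultimately have "norm (z' ^ ?N) \<le> t ^ ?N + norm c * (real ?N * t ^ (?N - 1)) * norm c"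
      by linarith
    then show "norm z' ^ ?N \<le> t ^ ?N + norm c * norm c * real ?N * t ^ (?N - 1)"
      unfolding norm_sa_power_two_power[OF sz'] by (simp add: mult_ac)
  qed simp
  then show ?thesis using t sz' unfolding pos_def z'_def
    by (intro conjI exI[of _ t]) (simp_all add: star_simps)
qed

lemma pos_absolute_value:
  fixes y :: "'a::{cstar_algebra,monoid_mult}"
  assumes "star y = y"
  obtains m where "pos m" "m * m = y * y" "m * y = y * m"
    "\<And>z. z * y = y * z \<Longrightarrow> z * m = m * z"
proof -
  obtain m where m: "pos m" "m * m = y * y" "\<And>z. z * (y * y) = (y * y) * z \<Longrightarrow> z * m = m * z"
    using pos_sqrt[OF pos_squareI[OF assms]] by metis
  have c: "z * m = m * z" if "z * y = y * z" for z
    by (rule m(3)) (metis mult.assoc that)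
  show thesis by (rule that[OF m(1,2) c[OF refl, symmetric] c])
qed

text \<open>The Kelley--Vaught theorem. Let \<open>y = b\<^sup>* b\<close>, let \<open>m\<close> be its absolute value, \<open>v = m - y\<close> (twice the
  negative part of \<open>y\<close>) and \<open>c = b v\<close>. Then \<open>y v = - m v\<close> gives \<open>c\<^sup>* c = - v m v \<le> 0\<close>, hence also
  \<open>c c\<^sup>* \<le> 0\<close>. With \<open>p\<close> and \<open>q\<close> the real and imaginary parts of \<open>c\<close>, the identity
  \<open>c\<^sup>* c + c c\<^sup>* = 2 (p\<^sup>2 + q\<^sup>2)\<close> then shows \<open>c\<^sup>* c \<ge> 0\<close>. So \<open>c\<^sup>* c = 0\<close>, which makes \<open>v\<close> vanish and
  leaves \<open>y = m \<ge> 0\<close>.\<close>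
theorem pos_star_mult:
  fixes b :: "'a::{cstar_algebra,monoid_mult}"
  shows "pos (star b * b)"
proof -
  define y where "y = star b * b"
  have sy: "star y = y" by (simp add: y_def star_simps)
  obtain m where m: "pos m" "m * m = y * y" "m * y = y * m"
    using pos_absolute_value[OF sy] by metis
  have sm: "star m = m" using m by (simp add: pos_sa)
  obtain n where n: "star n = n" "n * n = m" "\<And>z. z * m = m * z \<Longrightarrow> z * n = n * z"
    using pos_sqrt[OF m(1)] by metis
  define v where "v = m - y"
  have sv: "star v = v" by (simp add: v_def star_simps sm sy)
  have mv: "m * v = v * m" using m by (simp add: v_def algebra_simps)
  have yv: "y * v = - (m * v)" using m by (simp add: v_def algebra_simps)
  have vn: "v * n = n * v" using mv by (intro n(3)) simp
  define c where "c = b * v"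
  have cc: "star c * c = - ((n * v) * (n * v))"
  proof -
    have "star c * c = v * (y * v)" by (simp add: c_def star_mult sv y_def mult.assoc)
    also have "\<dots> = - (v * (n * n * v))" by (simp add: yv n(2))
    also have "v * (n * n * v) = (n * v) * (n * v)" using vn by (metis mult.assoc)
    finally show ?thesis .
  qed
  have snv: "star (n * v) = n * v" by (simp add: star_mult sv n(1) vn)
  have neg: "pos (- (star c * c))" using cc pos_squareI[OF snv] by simp
  then have neg': "pos (- (c * star c))" by (rule neg_star_mult_swap)
  define p q where "p = (1/2) *\<^sub>R (c + star c)" and "q = (\<i>/2) *\<^sub>C (star c - c)"
  have sp: "star p = p" by (simp add: p_def star_simps add.commute)
  have sq: "star q = q"
    by (simp add: q_def star_simps scaleC_minus_left scaleC_diff_right)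
  \<comment> \<open>Scaled to avoid the fractions in the real and imaginary parts.\<close>
  have pp: "4 *\<^sub>R (p * p) = (c + star c) * (c + star c)" by (simp add: p_def)
  have qq: "4 *\<^sub>R (q * q) = - ((star c - c) * (star c - c))"
    using scaleC_minus_left[of 1]
    by (simp add: q_def scaleC_mult_left scaleC_mult_right scaleC_scaleC scaleR_eq_scaleC)
  have sum: "star c * c + c * star c = 2 *\<^sub>R (p * p + q * q)"
  proof -
    have "2 *\<^sub>R (star c * c + c * star c) = 4 *\<^sub>R (p * p) + 4 *\<^sub>R (q * q)"
      unfolding pp qq by (simp add: algebra_simps scaleR_2)
    also have "\<dots> = 2 *\<^sub>R (2 *\<^sub>R (p * p + q * q))" by (simp add: scaleR_add_right)
    finally show ?thesis by (metis scaleR_cancel_left zero_neq_numeral)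
  qed
  have "pos (2 *\<^sub>R (p * p + q * q) + - (c * star c))"
    by (intro pos_add pos_scaleR pos_squareI sp sq neg') simp
  then have "pos (star c * c)" unfolding sum[symmetric] by simp
  then have "star c * c = 0" using neg pos_antisym by blast
  then have "n * v = 0" using cc snv sa_square_eq_0 by auto
  then have "m * v = 0" by (metis mult.assoc mult_zero_right n(2))
  then have "v * v = 0" using yv by (simp add: v_def left_diff_distrib)
  then have "v = 0" using sv sa_square_eq_0 by blast
  then have "m = y" by (simp add: v_def)
  then show ?thesis using m(1) unfolding y_def by simp
qed

lemma pos_conj:
  fixes h c :: "'a::{cstar_algebra,monoid_mult}"
  assumes "pos h" shows "pos (star c * h * c)"
proof -
  obtain y where y: "star y = y" "y * y = h" using pos_sqrt[OF assms] by metis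
  have "star c * h * c = star (y * c) * (y * c)"
    using y(1) by (simp add: star_mult mult.assoc flip: y(2))
  then show ?thesis by (simp add: pos_star_mult)
qed

text \<open>Here \<open>g = \<kappa> (\<kappa> + h)\<^sup>-\<^sup>1\<close>. With \<open>\<parallel>t - h\<parallel> \<le> t\<close>, the equation \<open>(\<kappa> + h) g = \<kappa>\<close> reads
  \<open>(\<kappa> + t) g = (t - h) g + \<kappa>\<close>, a fixed-point equation for a contraction with constant \<open>t / (\<kappa> + t)\<close>.
  The inequalities are those of the functions \<open>s \<mapsto> \<kappa> / (\<kappa> + s)\<close> and \<open>s \<mapsto> \<kappa>\<^sup>2 s / (\<kappa> + s)\<^sup>2\<close>, deduced
  algebraically from \<open>h g = \<kappa> (1 - g)\<close>.\<close>
lemma resolvent: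
  fixes h :: "'a::{cstar_algebra,monoid_mult}"
  assumes h: "pos h" and k: "\<kappa> > 0"
  obtains g where "pos g" "pos (1 - g)" "h * g = g * h" "h * g = \<kappa> *\<^sub>R (1 - g)"
    "pos ((1/\<kappa>) *\<^sub>R h - (1 - g))" "pos (\<kappa> *\<^sub>R 1 - g * h * g)"
proof -
  obtain t where t: "0 \<le> t" "norm (t *\<^sub>R 1 - h) \<le> t" using h by (auto simp: pos_def)
  define f where "f z = (1/(\<kappa>+t)) *\<^sub>R ((t *\<^sub>R 1 - h) * z + \<kappa> *\<^sub>R 1)" for z
  have "dist (f y) (f z) \<le> (t/(\<kappa>+t)) * dist y z" for y z
  proof -
    have "f y - f z = (1/(\<kappa>+t)) *\<^sub>R ((t *\<^sub>R 1 - h) * (y - z))"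
      by (simp add: f_def right_diff_distrib flip: scaleR_diff_right)
    then have "norm (f y - f z) = (1/(\<kappa>+t)) * norm ((t *\<^sub>R 1 - h) * (y - z))"
      using t k by simp
    also have "\<dots> \<le> (1/(\<kappa>+t)) * (t * norm (y - z))"
      using t k by (intro mult_left_mono order_trans[OF norm_mult_ineq] mult_right_mono) auto
    finally show ?thesis by (simp add: dist_norm)
  qed
  then have "\<exists>!g. f g = g"
    using t k by (intro banach_fix_type[where c = "t/(\<kappa>+t)"]) auto
  then obtain g where "f g = g" by blast
  then have "(\<kappa>+t) *\<^sub>R f g = (\<kappa>+t) *\<^sub>R g" by simp
  then have "(t *\<^sub>R 1 - h) * g + \<kappa> *\<^sub>R 1 = (\<kappa>+t) *\<^sub>R g" using t k by (simp add: f_def)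
  then have hg: "h * g = \<kappa> *\<^sub>R (1 - g)" by (simp add: algebra_simps)
  have sh: "star h = h" using h by (simp add: pos_sa)
  have sgh: "star g * h = \<kappa> *\<^sub>R (1 - star g)"
    using arg_cong[OF hg, of star] by (simp add: star_simps sh)
  have "star g * (h * g) = (star g * h) * g" by (simp add: mult.assoc)
  then have "\<kappa> *\<^sub>R (star g - star g * g) = \<kappa> *\<^sub>R (g - star g * g)"
    unfolding hg sgh by (simp add: algebra_simps)
  then have sg: "star g = g" using k by simp
  have gh: "h * g = g * h" using sgh hg sg by simp
  have "\<kappa> *\<^sub>R g = \<kappa> *\<^sub>R (g * g) + g * (h * g)" unfolding hg by (simp add: algebra_simps)
  then have "g = (1/\<kappa>) *\<^sub>R (\<kappa> *\<^sub>R (g * g) + g * (h * g))" using k by (metis divide_inverse mult_1 scaleR_scaleR left_inverse scaleR_one less_irrefl)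
  moreover have "pos (g * h * g)" using pos_conj[OF h, of g] sg by simp
  ultimately have g: "pos g"
    using k sg by (metis less_imp_le mult.assoc pos_add pos_scaleR pos_squareI zero_le_divide_1_iff)
  have g1: "1 - g = (1/\<kappa>) *\<^sub>R (h * g)" using hg k by simp
  then have pg1: "pos (1 - g)" using pos_commute_mult[OF h g gh] k by (simp add: pos_scaleR)
  have "(1/\<kappa>) *\<^sub>R h - (1 - g) = (1/\<kappa>) *\<^sub>R (h * (1 - g))"
    unfolding right_diff_distrib scaleR_diff_right using g1 by simp
  moreover have "pos (h * (1 - g))"
    using gh by (intro pos_commute_mult h pg1) (simp add: algebra_simps)
  ultimately have 5: "pos ((1/\<kappa>) *\<^sub>R h - (1 - g))" using k by (simp add: pos_scaleR)
  have "g * h * g = \<kappa> *\<^sub>R (g - g * g)" by (simp add: mult.assoc hg right_diff_distrib)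
  then have "\<kappa> *\<^sub>R 1 - g * h * g = \<kappa> *\<^sub>R ((1 - g) + g * g)" by (simp add: algebra_simps)
  then have 6: "pos (\<kappa> *\<^sub>R 1 - g * h * g)"
    using k pos_add[OF pg1 pos_squareI[OF sg]] by (simp add: pos_scaleR)
  show thesis by (rule that[OF g pg1 gh hg 5 6])
qed

text \<open>Used for \<open>n = (m \<plusminus> u) / 2\<close> with \<open>m\<close> the absolute value of \<open>u\<close>. Let \<open>N\<close> be the absolute value of \<open>n\<close> and
  \<open>v = N - n\<close>. Then \<open>n v = - N v\<close> and \<open>n\<^sup>2 = m n\<close> give \<open>(N v)\<^sup>2 = - m N v\<^sup>2\<close>, an element that is
  positive by its left side and negative by its right side; so it is zero, and \<open>n = N\<close>.\<close>
lemma pos_of_square_eq_mult: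
  fixes n m :: "'a::{cstar_algebra,monoid_mult}"
  assumes sn: "star n = n" and m: "pos m" and mn: "m * n = n * m" and nn: "n * n = m * n"
  shows "pos n"
proof -
  obtain N where N: "pos N" "N * N = n * n" "N * n = n * N"
      and c: "\<And>z. z * n = n * z \<Longrightarrow> z * N = N * z"
    using pos_absolute_value[OF sn] by metis
  have mN: "m * N = N * m" using c[OF mn] .
  define v where "v = N - n"
  have sv: "star v = v" using N(1) sn by (simp add: v_def star_simps pos_sa)
  have cm: "N * v = v * N" "m * v = v * m" "n * v = v * n"
    using N(3) mN mn by (simp_all add: v_def algebra_simps)
  have nv: "n * v = - (N * v)" using N(2,3) by (simp add: v_def algebra_simps)
  have "N * (N * v) = - (m * (N * v))"
  proof -
    have "N * (N * v) = n * n * v" using N(2) by (simp flip: mult.assoc)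
    also have "\<dots> = m * (n * v)" by (simp add: nn mult.assoc)
    finally show ?thesis by (simp add: nv)
  qed
  then have "N * (N * v) * v = - (m * (N * v)) * v" by simp
  then have eq: "(N * v) * (N * v) = - ((m * N) * (v * v))"
    using cm(1) by (simp add: mult.assoc) (metis mult.assoc)
  have sNv: "star (N * v) = N * v" using N(1) sv cm(1) by (simp add: star_mult pos_sa)
  have "(m * N) * (v * v) = (v * v) * (m * N)" using cm(1,2) by (metis mult.assoc)
  then have "pos ((m * N) * (v * v))"
    by (rule pos_commute_mult[OF pos_commute_mult[OF m N(1) mN] pos_squareI[OF sv]])
  then have "(N * v) * (N * v) = 0"
    using eq pos_squareI[OF sNv] pos_antisym[of "(N * v) * (N * v)"] by simp
  then have "N * v = 0" using sNv sa_square_eq_0 by blast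
  moreover have "v * v = N * v - n * v" by (simp add: v_def left_diff_distrib)
  ultimately have "v * v = 0" using nv by simp
  then have "v = 0" using sv sa_square_eq_0 by blast
  then show ?thesis using N(1) by (simp add: v_def)
qed

lemma positive_negative_parts:
  fixes u :: "'a::{cstar_algebra,monoid_mult}"
  assumes su: "star u = u"
  obtains n n' where "pos n" "pos n'" "u = n - n'" "n * n' = 0" "n' * n = 0"
    "(n + n') * (n + n') = u * u"
proof -
  obtain m where m: "pos m" "m * m = u * u" "m * u = u * m"
    using pos_absolute_value[OF su] by metis
  define n n' where "n = (1/2) *\<^sub>R (m + u)" and "n' = (1/2) *\<^sub>R (m - u)"
  have "star n = n" "star n' = n'" using m(1) su by (simp_all add: n_def n'_def star_simps pos_sa)
  moreover have "m * n = n * m" "m * n' = n' * m" using m(3) by (simp_all add: n_def n'_def algebra_simps)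
  moreover have "n * n = m * n" "n' * n' = m * n'"
    using m(2,3) by (simp_all add: n_def n'_def algebra_simps flip: scaleR_add_left)
  ultimately have "pos n" "pos n'" using m(1) pos_of_square_eq_mult by blast+
  moreover have "u = n - n'"
    by (simp add: n_def n'_def flip: scaleR_diff_right)
  moreover have "n * n' = 0" "n' * n = 0" using m(2,3) by (simp_all add: n_def n'_def algebra_simps)
  moreover have "n + n' = m"
    by (simp add: n_def n'_def flip: scaleR_add_right)
  ultimately show thesis using that m(2) by simp
qed

text \<open>Multiplying \<open>n - n' \<le> M\<close> on both sides by \<open>sqrt n\<close>, which annihilates \<open>n'\<close>, gives \<open>n\<^sup>2 \<le> M n\<close>,
  and therefore \<open>\<parallel>n\<parallel>\<^sup>2 \<le> M \<parallel>n\<parallel>\<close>.\<close>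
lemma positive_part_le:
  fixes n :: "'a::{cstar_algebra,monoid_mult}"
  assumes n: "pos n" and nn': "n * n' = 0" "n' * n = 0" and M: "0 \<le> M" "pos (M *\<^sub>R 1 - (n - n'))"
  shows "norm n \<le> M"
proof -
  have sn: "star n = n" using n by (simp add: pos_sa)
  obtain r where r: "pos r" "star r = r" "r * r = n" "\<And>z. z * n = n * z \<Longrightarrow> z * r = r * z"
    using pos_sqrt[OF n] by metis
  have c: "n' * r = r * n'" by (rule r(4)) (simp add: nn')
  have "star (r * n') * (r * n') = star n' * (n * n')"
    by (simp add: star_mult r(2) mult.assoc flip: r(3))
  then have rn': "r * n' = 0" using nn' star_mult_self_eq_0[of "r * n'"] by simp
  have nr: "n * r = r * n" by (metis mult.assoc r(3))
  have "pos (star r * (M *\<^sub>R 1 - (n - n')) * r)" by (rule pos_conj[OF M(2)])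
  moreover have "star r * (M *\<^sub>R 1 - (n - n')) * r = M *\<^sub>R n - n * n"
  proof -
    have "r * n * r = n * n" by (metis mult.assoc nr r(3))
    then show ?thesis using rn' by (simp add: r(2,3) algebra_simps)
  qed
  ultimately have "pos (M *\<^sub>R n - n * n)" by simp
  then have "norm (n * n) \<le> norm (M *\<^sub>R n)" by (rule norm_mono_pos[OF pos_squareI[OF sn]])
  then have "norm n * norm n \<le> M * norm n" using norm_sa_square[OF sn] M by (simp add: power2_eq_square)
  then show ?thesis using M by (metis mult_le_cancel_right norm_ge_zero not_less_iff_gr_or_eq order_le_less)
qed

section \<open>Unitization\<close>

text \<open>A separate type, rather than the product with the complex numbers, because the product carries a
  norm of its own that is not a C*-norm.\<close>
datatype 'a unitization = Unitize (alg: 'a) (scal: complex)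

lemma unitization_eqI: "alg z = alg w \<Longrightarrow> scal z = scal w \<Longrightarrow> z = w"
  by (rule unitization.expand) simp

instantiation unitization :: (cstar_algebra) "{real_algebra, monoid_mult}"
begin

definition "0 = Unitize 0 0"
definition "1 = Unitize 0 1"
definition "z + w = Unitize (alg z + alg w) (scal z + scal w)"
definition "z - w = Unitize (alg z - alg w) (scal z - scal w)"
definition "- z = Unitize (- alg z) (- scal z)"
definition "z * w = Unitize (alg z * alg w + scal z *\<^sub>C alg w + scal w *\<^sub>C alg z) (scal z * scal w)"
definition "r *\<^sub>R z = Unitize (r *\<^sub>R alg z) (r *\<^sub>R scal z)"

lemma alg_scal_simps [simp]:
  "alg (0::'a unitization) = 0" "scal (0::'a unitization) = 0"
  "alg (1::'a unitization) = 0" "scal (1::'a unitization) = 1"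
  "alg (z + w) = alg z + alg w" "scal (z + w) = scal z + scal w"
  "alg (z - w) = alg z - alg w" "scal (z - w) = scal z - scal w"
  "alg (- z) = - alg z" "scal (- z) = - scal z"
  "alg (z * w) = alg z * alg w + scal z *\<^sub>C alg w + scal w *\<^sub>C alg z" "scal (z * w) = scal z * scal w"
  "alg (r *\<^sub>R z) = r *\<^sub>R alg z" "scal (r *\<^sub>R z) = r *\<^sub>R scal z"
  for z w :: "'a unitization"
  by (simp_all add: zero_unitization_def one_unitization_def plus_unitization_def
      minus_unitization_def uminus_unitization_def times_unitization_def scaleR_unitization_def)

instance
  by standard
    (auto intro!: unitization_eqI simp: algebra_simps scaleC_add_left scaleC_add_right scaleC_scaleC
      scaleC_mult_left scaleC_mult_right scaleR_eq_scaleC scaleR_conv_of_real)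

end

text \<open>The unitization acts on the algebra by left multiplication. The operator norm of this action is a
  C*-seminorm; it fails to be a norm if the algebra already has a unit, which the maximum with
  the modulus of the scalar part repairs.\<close>
definition act :: "'a::cstar_algebra unitization \<Rightarrow> 'a \<Rightarrow> 'a"
  where "act z x = alg z * x + scal z *\<^sub>C x"

lemma bounded_linear_scaleC: "bounded_linear (\<lambda>x::'a::cstar_algebra. c *\<^sub>C x)"
  by (rule bounded_linear_intro[where K = "cmod c"])
    (simp_all add: scaleC_add_right scaleR_eq_scaleC scaleC_scaleC norm_scaleC mult.commute)

lemma bounded_linear_act: "bounded_linear (act z)"
  unfolding act_def
  by (intro bounded_linear_add bounded_linear_mult_right bounded_linear_scaleC)

lemma act_simps:
  "act (z + w) x = act z x + act w x" "act (z * w) x = act z (act w x)"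
  "act (r *\<^sub>R z) x = r *\<^sub>R act z x" "act 0 x = 0"
  for z w :: "'a::cstar_algebra unitization"
  by (simp_all add: act_def algebra_simps scaleC_add_left scaleC_add_right scaleC_scaleC
      scaleC_mult_left scaleC_mult_right scaleR_eq_scaleC scaleR_conv_of_real)

lemma onorm_act_Unitize_0: "onorm (act (Unitize a 0)) = norm (a::'a::cstar_algebra)"
proof (rule antisym)
  show "onorm (act (Unitize a 0)) \<le> norm a"
    by (rule onorm_bound) (simp_all add: act_def norm_mult_ineq)
  have "norm (a * star a) \<le> onorm (act (Unitize a 0)) * norm (star a)"
    using onorm[OF bounded_linear_act, of "Unitize a 0" "star a"] by (simp add: act_def)
  then have "norm a * norm a \<le> onorm (act (Unitize a 0)) * norm a"
    by (simp add: norm_self_mult_star power2_eq_square)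
  then show "norm a \<le> onorm (act (Unitize a 0))"
    using onorm_pos_le[OF bounded_linear_act, of "Unitize a 0"]
    by (cases "a = 0") auto
qed

instantiation unitization :: (cstar_algebra) real_normed_algebra
begin

definition "norm z = max (onorm (act z)) (cmod (scal z))"
definition "sgn z = z /\<^sub>R norm z" for z :: "'a unitization"
definition "dist z w = norm (z - w)" for z w :: "'a unitization"
definition "(uniformity :: ('a unitization \<times> 'a unitization) filter) = (INF e\<in>{0<..}. principal {(x, y). dist x y < e})"
definition "open (U :: 'a unitization set) \<longleftrightarrow> (\<forall>x\<in>U. \<forall>\<^sub>F (x', y) in uniformity. x' = x \<longrightarrow> y \<in> U)"

instance
proof
  fix x y :: "'a unitization" and a :: real
  show "dist x y = norm (x - y)" "sgn x = x /\<^sub>R norm x"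
    by (simp_all add: dist_unitization_def sgn_unitization_def)
  show "(norm x = 0) = (x = 0)"
  proof
    assume n: "norm x = 0"
    then have "cmod (scal x) \<le> 0" "onorm (act x) \<le> 0" by (auto simp: norm_unitization_def max_def split: if_splits)
    then have s: "scal x = 0" by simp
    then have "x = Unitize (alg x) 0" by (simp add: unitization.expand)
    then have "norm (alg x) \<le> 0" using \<open>onorm (act x) \<le> 0\<close> onorm_act_Unitize_0 by metis
    then show "x = 0" using s by (intro unitization_eqI) auto
  next
    assume "x = 0"
    moreover have "act (0::'a unitization) = (\<lambda>x. 0)" by (rule ext) (simp add: act_simps)
    ultimately show "norm x = 0" by (simp add: norm_unitization_def onorm_zero)
  qed
  show "norm (x + y) \<le> norm x + norm y"
  proof -
    have "act (x + y) = (\<lambda>v. act x v + act y v)" by (rule ext) (simp add: act_simps)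
    then have "onorm (act (x + y)) \<le> onorm (act x) + onorm (act y)"
      using onorm_triangle[OF bounded_linear_act bounded_linear_act] by metis
    then show ?thesis using norm_triangle_ineq[of "scal x" "scal y"] by (auto simp: norm_unitization_def)
  qed
  show "norm (a *\<^sub>R x) = \<bar>a\<bar> * norm x"
  proof -
    have "act (a *\<^sub>R x) = (\<lambda>v. a *\<^sub>R act x v)" by (rule ext) (simp add: act_simps)
    then have "onorm (act (a *\<^sub>R x)) = \<bar>a\<bar> * onorm (act x)"
      using onorm_scaleR[OF bounded_linear_act] by metis
    then show ?thesis by (simp add: norm_unitization_def max_mult_distrib_left)
  qed
  show "norm (x * y) \<le> norm x * norm y"
  proof -
    have "act (x * y) = act x \<circ> act y" by (rule ext) (simp add: act_simps)
    then have "onorm (act (x * y)) \<le> onorm (act x) * onorm (act y)"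
      using onorm_compose[OF bounded_linear_act bounded_linear_act] by metis
    also have "\<dots> \<le> norm x * norm y"
      by (intro mult_mono) (auto simp: norm_unitization_def intro!: onorm_pos_le bounded_linear_act le_max_iff_disj[THEN iffD2])
    finally have "onorm (act (x * y)) \<le> norm x * norm y" .
    moreover have "cmod (scal (x * y)) \<le> norm x * norm y"
      by (auto simp: norm_mult norm_unitization_def intro!: mult_mono le_max_iff_disj[THEN iffD2])
    ultimately show ?thesis by (subst norm_unitization_def) simp
  qed
qed (simp_all only: uniformity_unitization_def open_unitization_def)

end

lemma norm_Unitize_0: "norm (Unitize a 0) = norm (a::'a::cstar_algebra)"
  by (simp add: norm_unitization_def onorm_act_Unitize_0)

lemma norm_scal_le: "cmod (scal z) \<le> norm (z::'a::cstar_algebra unitization)"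
  by (simp add: norm_unitization_def)

lemma onorm_act_scalar_le: "onorm (act (Unitize (0::'a::cstar_algebra) c)) \<le> cmod c"
  by (rule onorm_bound) (simp_all add: act_def norm_scaleC)

lemma unitize_split: "z = Unitize (alg z) 0 + Unitize 0 (scal z)"
  for z :: "'a::cstar_algebra unitization"
  by (rule unitization_eqI) simp_all

lemma norm_unitization_le: "norm z \<le> norm (alg z) + cmod (scal z)"
  for z :: "'a::cstar_algebra unitization"
proof -
  have "norm z \<le> norm (Unitize (alg z) 0) + norm (Unitize (0::'a) (scal z))"
    by (subst unitize_split) (rule norm_triangle_ineq)
  moreover have "norm (Unitize (0::'a) (scal z)) \<le> cmod (scal z)"
    using onorm_act_scalar_le by (simp add: norm_unitization_def)
  ultimately show ?thesis by (simp add: norm_Unitize_0)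
qed

lemma norm_alg_le: "norm (alg z) \<le> 2 * norm z"
  for z :: "'a::cstar_algebra unitization"
proof -
  have "Unitize (alg z) 0 = z - Unitize 0 (scal z)" by (rule unitization_eqI) simp_all
  then have "norm (alg z) \<le> norm z + norm (Unitize (0::'a) (scal z))"
    by (metis norm_Unitize_0 norm_triangle_ineq4)
  moreover have "norm (Unitize (0::'a) (scal z)) \<le> cmod (scal z)"
    using onorm_act_scalar_le by (simp add: norm_unitization_def)
  ultimately show ?thesis using norm_scal_le[of z] by linarith
qed

instantiation unitization :: (cstar_algebra) cstar_algebra
begin

definition "c *\<^sub>C z = Unitize (c *\<^sub>C alg z) (c * scal z)"
definition "star z = Unitize (star (alg z)) (cnj (scal z))"

lemma scaleC_star_alg_scal [simp]:
  "alg (c *\<^sub>C z) = c *\<^sub>C alg z" "scal (c *\<^sub>C z) = c * scal z"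
  "alg (star z) = star (alg z)" "scal (star z) = cnj (scal z)"
  for z :: "'a unitization"
  by (simp_all add: scaleC_unitization_def star_unitization_def)

lemma star_act: "star (act z x) * y = star x * act (star z) (y::'a)"
  by (simp add: act_def star_simps algebra_simps scaleC_mult_left scaleC_mult_right)

lemma star_mult_unitization: "star (z * w) = star w * star (z::'a unitization)"
  by (rule unitization_eqI) (simp_all add: star_simps algebra_simps)

text \<open>As for Hilbert space operators: \<open>star_act\<close> says that the adjoint acts as an adjoint with respect to
  \<open>x\<^sup>* y\<close>, so \<open>\<parallel>z x\<parallel>\<^sup>2 = \<parallel>x\<^sup>* (z\<^sup>* z x)\<parallel>\<close>.\<close>
lemma onorm_act_square_le: "(onorm (act z))\<^sup>2 \<le> onorm (act (star z * (z::'a unitization)))"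
proof -
  let ?K = "onorm (act (star z * z))"
  have K: "0 \<le> ?K" by (intro onorm_pos_le bounded_linear_act)
  have "norm (act z x) \<le> sqrt ?K * norm x" for x
  proof -
    have "(norm (act z x))\<^sup>2 = norm (star x * act (star z * z) x)"
      by (simp add: act_simps flip: norm_star_mult_self star_act)
    also have "\<dots> \<le> norm x * (?K * norm x)"
      by (rule order_trans[OF norm_mult_ineq])
        (simp add: mult_left_mono onorm bounded_linear_act)
    also have "\<dots> = (sqrt ?K * norm x)\<^sup>2" using K by (simp add: power_mult_distrib power2_eq_square)
    finally show ?thesis by (rule power2_le_imp_le) (use K in simp)
  qed
  then have "onorm (act z) \<le> sqrt ?K" using K by (intro onorm_bound) auto
  then show ?thesis using K
    by (metis onorm_pos_le[OF bounded_linear_act] power_mono real_sqrt_pow2)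
qed

lemma norm_square_le_unitization: "(norm z)\<^sup>2 \<le> norm (star z * (z::'a unitization))"
proof -
  have "(cmod (scal z))\<^sup>2 = cmod (scal (star z * z))" by (simp add: norm_mult power2_eq_square)
  then show ?thesis using onorm_act_square_le[of z]
    unfolding norm_unitization_def by (auto simp: max_def)
qed

instance
proof
  fix c d :: complex and x y :: "'a unitization" and r :: real
  show "c *\<^sub>C (x + y) = c *\<^sub>C x + c *\<^sub>C y" "(c + d) *\<^sub>C x = c *\<^sub>C x + d *\<^sub>C x"
    "c *\<^sub>C (d *\<^sub>C x) = (c * d) *\<^sub>C x" "r *\<^sub>R x = complex_of_real r *\<^sub>C x"
    "(c *\<^sub>C x) * y = c *\<^sub>C (x * y)" "x * (c *\<^sub>C y) = c *\<^sub>C (x * y)"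
    "star (star x) = x" "star (x + y) = star x + star y" "star (c *\<^sub>C x) = cnj c *\<^sub>C star x"
    by (auto intro!: unitization_eqI simp: algebra_simps scaleC_add_left scaleC_add_right scaleC_scaleC
      scaleC_mult_left scaleC_mult_right scaleR_eq_scaleC scaleR_conv_of_real star_simps)
  show "star (x * y) = star y * star x" by (rule star_mult_unitization)
  show "norm (c *\<^sub>C x) = cmod c * norm x"
  proof -
    have "onorm (act (c *\<^sub>C z)) \<le> cmod c * onorm (act z)" for c and z :: "'a unitization"
    proof (rule onorm_bound)
      show "0 \<le> cmod c * onorm (act z)" by (simp add: onorm_pos_le bounded_linear_act)
      fix x
      have "act (c *\<^sub>C z) x = c *\<^sub>C act z x"
        by (simp add: act_def scaleC_mult_left scaleC_add_right scaleC_scaleC)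
      then show "norm (act (c *\<^sub>C z) x) \<le> cmod c * onorm (act z) * norm x"
        using onorm[OF bounded_linear_act, of z x] by (simp add: norm_scaleC mult.assoc mult_left_mono)
    qed
    then have le: "norm (c *\<^sub>C z) \<le> cmod c * norm z" for c and z :: "'a unitization"
      by (auto simp: norm_unitization_def norm_mult max_mult_distrib_left intro: max.coboundedI1)
    have "cmod c * norm x \<le> norm (c *\<^sub>C x)"
    proof (cases "c = 0")
      case False
      then have "x = inverse c *\<^sub>C (c *\<^sub>C x)" by (intro unitization_eqI) (simp_all add: scaleC_scaleC)
      then have "norm x \<le> cmod (inverse c) * norm (c *\<^sub>C x)" using le by metis
      then show ?thesis using False by (simp add: norm_inverse norm_divide field_simps)
    qed simp
    then show ?thesis using le by (simp add: antisym)
  qed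
  have ns: "norm z \<le> norm (star z)" for z :: "'a unitization"
  proof (cases "z = 0")
    case False
    have "norm z * norm z \<le> norm (star z) * norm z"
      using order_trans[OF norm_square_le_unitization norm_mult_ineq] by (simp add: power2_eq_square)
    then show ?thesis using False by simp
  qed simp
  have "star (star x) = x" by (rule unitization_eqI) (simp_all add: star_simps)
  then have "norm (star x) = norm x" using ns[of x] ns[of "star x"] by simp
  then show "norm (star x * x) = (norm x)\<^sup>2"
    using norm_mult_ineq[of "star x" x] norm_square_le_unitization[of x] by (simp add: power2_eq_square)
  show "convergent X" if X: "Cauchy X" for X :: "nat \<Rightarrow> 'a unitization"
  proof -
    have "Cauchy (\<lambda>n. alg (X n))"
    proof (rule metric_CauchyI)
      fix e :: real assume "0 < e"
      then obtain M where M: "\<forall>m\<ge>M. \<forall>n\<ge>M. dist (X m) (X n) < e / 2"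
        using metric_CauchyD[OF X, of "e/2"] by auto
      have "dist (alg (X m)) (alg (X n)) < e" if "m \<ge> M" "n \<ge> M" for m n
        using norm_alg_le[of "X m - X n"] M that by (fastforce simp: dist_norm)
      then show "\<exists>M. \<forall>m\<ge>M. \<forall>n\<ge>M. dist (alg (X m)) (alg (X n)) < e" by blast
    qed
    then obtain a where a: "(\<lambda>n. alg (X n)) \<longlonglongrightarrow> a" using Cauchy_convergent convergent_def by blast
    have "Cauchy (\<lambda>n. scal (X n))"
    proof (rule metric_CauchyI)
      fix e :: real assume "0 < e"
      then obtain M where M: "\<forall>m\<ge>M. \<forall>n\<ge>M. dist (X m) (X n) < e"
        using metric_CauchyD[OF X, of e] by auto
      have "dist (scal (X m)) (scal (X n)) < e" if "m \<ge> M" "n \<ge> M" for m n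
        using norm_scal_le[of "X m - X n"] M that by (fastforce simp: dist_norm)
      then show "\<exists>M. \<forall>m\<ge>M. \<forall>n\<ge>M. dist (scal (X m)) (scal (X n)) < e" by blast
    qed
    then obtain l where l: "(\<lambda>n. scal (X n)) \<longlonglongrightarrow> l" using Cauchy_convergent convergent_def by blast
    have "(\<lambda>n. norm (alg (X n) - a) + cmod (scal (X n) - l)) \<longlonglongrightarrow> 0 + 0"
      by (intro tendsto_add) (use a l in \<open>simp_all add: LIM_zero tendsto_norm_zero\<close>)
    then have lim: "(\<lambda>n. norm (alg (X n) - a) + cmod (scal (X n) - l)) \<longlonglongrightarrow> 0" by simp
    have "norm (X n - Unitize a l) \<le> norm (alg (X n) - a) + cmod (scal (X n) - l)" for n
      using norm_unitization_le[of "X n - Unitize a l"] by simp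
    then have "(\<lambda>n. X n - Unitize a l) \<longlonglongrightarrow> 0"
      by (intro Lim_null_comparison[OF _ lim] always_eventually allI)
    then show "convergent X" unfolding convergent_def using LIM_zero_cancel by blast
  qed
qed

end

lemma Unitize_0_simps:
  fixes x y :: "'a::cstar_algebra"
  shows "Unitize (x + y) 0 = Unitize x 0 + Unitize y 0"
    "Unitize (c *\<^sub>C x) 0 = c *\<^sub>C Unitize x 0" "Unitize (r *\<^sub>R x) 0 = r *\<^sub>R Unitize x 0"
    "Unitize (star x * x) 0 = star (Unitize x 0) * Unitize x 0"
  by (auto intro!: unitization_eqI)

section \<open>Positive functionals\<close>

text \<open>Positivity on the elements \<open>x\<^sup>* x\<close> and linearity, with no continuity assumption: boundedness is
  automatic in the unital case (\<open>pf_norm_le\<close>), where the functionals produced below live.\<close>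
definition positive_functional :: "('a::cstar_algebra \<Rightarrow> complex) \<Rightarrow> bool"
  where "positive_functional \<omega> \<longleftrightarrow>
    (\<forall>x y. \<omega> (x + y) = \<omega> x + \<omega> y) \<and> (\<forall>c x. \<omega> (c *\<^sub>C x) = c * \<omega> x) \<and>
    (\<forall>x. \<omega> (star x * x) \<in> \<real>\<^sub>\<ge>\<^sub>0)"

context
  fixes \<omega> :: "'a::cstar_algebra \<Rightarrow> complex"
  assumes w: "positive_functional \<omega>"
begin

lemma pf_add: "\<omega> (x + y) = \<omega> x + \<omega> y"
  and pf_scaleC: "\<omega> (c *\<^sub>C x) = c * \<omega> x"
  and pf_star_mult: "\<omega> (star x * x) \<in> \<real>\<^sub>\<ge>\<^sub>0"
  using w by (auto simp: positive_functional_def)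

lemma pf_0: "\<omega> 0 = 0" using pf_scaleC[of 0 0] by simp

lemma pf_minus: "\<omega> (- x) = - \<omega> x" using pf_scaleC[of "-1" x] by simp

lemma pf_diff: "\<omega> (x - y) = \<omega> x - \<omega> y" using pf_add[of x "-y"] by (simp add: pf_minus)

lemma pf_scaleR: "\<omega> (r *\<^sub>R x) = of_real r * \<omega> x" by (simp add: scaleR_eq_scaleC pf_scaleC)

lemma pf_sum: "finite I \<Longrightarrow> \<omega> (\<Sum>i\<in>I. f i) = (\<Sum>i\<in>I. \<omega> (f i))"
  by (induction I rule: finite_induct) (simp_all add: pf_0 pf_add)

lemma pf_hermitian_form: "\<omega> (star x * y) = cnj (\<omega> (star y * x))"
proof -
  define r r' where "r = \<omega> (star y * x)" and "r' = \<omega> (star x * y)"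
  have e: "\<omega> (star (x + c *\<^sub>C y) * (x + c *\<^sub>C y)) =
      \<omega> (star x * x) + c * r' + cnj c * r + cnj c * c * \<omega> (star y * y)" for c
    by (simp add: star_simps distrib_left distrib_right scaleC_mult_left scaleC_mult_right
        scaleC_scaleC pf_add pf_scaleC r_def r'_def)
  have i: "Im (\<omega> (star z * z)) = 0" for z
    using pf_star_mult[of z] by (simp add: complex_nonneg_Reals_iff)
  have "Im (r' + r) = 0" using i[of "x + 1 *\<^sub>C y"] i[of x] i[of y] unfolding e by simp
  moreover have "Re (r' - r) = 0" using i[of "x + \<i> *\<^sub>C y"] i[of x] i[of y] unfolding e by simp
  ultimately have "r' = cnj r" by (simp add: complex_eq_iff)
  then show ?thesis by (simp add: r_def r'_def)
qed

lemma cauchy_schwarz: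
  "(cmod (\<omega> (star y * x)))\<^sup>2 \<le> Re (\<omega> (star x * x)) * Re (\<omega> (star y * y))"
proof -
  define r p q where "r = \<omega> (star y * x)" and "p = Re (\<omega> (star x * x))" and "q = Re (\<omega> (star y * y))"
  have pq: "0 \<le> p" "0 \<le> q"
    using pf_star_mult by (simp_all add: p_def q_def complex_nonneg_Reals_iff)
  have quad: "0 \<le> p - 2 * t * (cmod r)\<^sup>2 + t\<^sup>2 * (cmod r)\<^sup>2 * q" for t :: real
  proof -
    define c where "c = - of_real t * r"
    have "\<omega> (star (x + c *\<^sub>C y) * (x + c *\<^sub>C y)) =
        \<omega> (star x * x) + c * cnj r + cnj c * r + cnj c * c * \<omega> (star y * y)"
      by (simp add: star_simps distrib_left distrib_right scaleC_mult_left scaleC_mult_right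
        scaleC_scaleC pf_add pf_scaleC r_def pf_hermitian_form[of x y])
    also have "c * cnj r = - of_real (t * (cmod r)\<^sup>2)"
      unfolding of_real_mult complex_norm_square by (simp add: c_def)
    also have "cnj c * r = - of_real (t * (cmod r)\<^sup>2)"
      unfolding of_real_mult complex_norm_square by (simp add: c_def)
    also have "cnj c * c = of_real (t\<^sup>2 * (cmod r)\<^sup>2)"
      unfolding of_real_mult complex_norm_square by (simp add: c_def power2_eq_square)
    finally have "Re (\<omega> (star (x + c *\<^sub>C y) * (x + c *\<^sub>C y))) = p - 2 * t * (cmod r)\<^sup>2 + t\<^sup>2 * (cmod r)\<^sup>2 * q"
      by (simp add: p_def q_def)
    then show ?thesis using pf_star_mult[of "x + c *\<^sub>C y"] by (simp add: complex_nonneg_Reals_iff)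
  qed
  have "(cmod r)\<^sup>2 \<le> p * q"
  proof (cases "q = 0")
    case True
    have "(cmod r)\<^sup>2 \<le> 0"
    proof (rule ccontr)
      assume "\<not> (cmod r)\<^sup>2 \<le> 0"
      then have "2 * ((p + 1) / (cmod r)\<^sup>2) * (cmod r)\<^sup>2 = 2 * (p + 1)" by simp
      then show False using quad[of "(p + 1) / (cmod r)\<^sup>2"] True pq by simp
    qed
    then show ?thesis using True by simp
  next
    case False
    then have "q > 0" using pq by simp
    then show ?thesis using quad[of "1 / q"] by (simp add: power2_eq_square field_simps)
  qed
  then show ?thesis by (simp add: r_def p_def q_def)
qed

end

context
  fixes \<omega> :: "'a::{cstar_algebra,monoid_mult} \<Rightarrow> complex"
  assumes w: "positive_functional \<omega>"
begin

lemma pf_pos: assumes "pos h" shows "0 \<le> Re (\<omega> h)" "Im (\<omega> h) = 0"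
proof -
  obtain y where "star y = y" "y * y = h" using pos_sqrt[OF assms] by metis
  then show "0 \<le> Re (\<omega> h)" "Im (\<omega> h) = 0"
    using pf_star_mult[OF w, of y] by (simp_all add: complex_nonneg_Reals_iff)
qed

lemma pf_mono: "pos (k - h) \<Longrightarrow> Re (\<omega> h) \<le> Re (\<omega> k)"
  using pf_pos[of "k - h"] by (simp add: pf_diff[OF w])

lemma pf_star: "\<omega> (star x) = cnj (\<omega> x)"
  using pf_hermitian_form[OF w, of x 1] by simp

lemma pf_sa:
  assumes "star x = x" shows "Im (\<omega> x) = 0"
proof -
  have "Im (\<omega> (star x)) = - Im (\<omega> x)" unfolding pf_star by simp
  then show ?thesis unfolding assms by simp
qed

lemma pf_one_ge_0: "0 \<le> Re (\<omega> 1)"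
  using pf_pos[of 1] by simp

lemma pf_square_le: "Re (\<omega> (star x * x)) \<le> (norm x)\<^sup>2 * Re (\<omega> 1)"
proof -
  have "pos ((norm x)\<^sup>2 *\<^sub>R 1 - star x * x)"
    by (rule pos_norm_diff) (simp_all add: star_simps norm_star_mult_self)
  from pf_mono[OF this] show ?thesis by (simp add: pf_scaleR[OF w])
qed

lemma pf_norm_le: "cmod (\<omega> x) \<le> Re (\<omega> 1) * norm x"
proof -
  have "(cmod (\<omega> x))\<^sup>2 \<le> Re (\<omega> (star x * x)) * Re (\<omega> 1)"
    using cauchy_schwarz[OF w, of 1 x] by simp
  also have "\<dots> \<le> ((norm x)\<^sup>2 * Re (\<omega> 1)) * Re (\<omega> 1)"
    by (intro mult_right_mono pf_square_le pf_one_ge_0)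
  also have "\<dots> = (Re (\<omega> 1) * norm x)\<^sup>2" by (simp add: power2_eq_square)
  finally show ?thesis by (rule power2_le_imp_le) (simp add: pf_one_ge_0)
qed

lemma pf_conj: "positive_functional (\<lambda>x. \<omega> (star c * x * c))"
  unfolding positive_functional_def
proof (intro conjI allI)
  fix x y :: 'a and d
  show "\<omega> (star c * (x + y) * c) = \<omega> (star c * x * c) + \<omega> (star c * y * c)"
    by (simp add: algebra_simps pf_add[OF w])
  show "\<omega> (star c * (d *\<^sub>C x) * c) = d * \<omega> (star c * x * c)"
    by (simp add: scaleC_mult_left scaleC_mult_right pf_scaleC[OF w])
  show "\<omega> (star c * (star x * x) * c) \<in> \<real>\<^sub>\<ge>\<^sub>0"
    using pf_star_mult[OF w, of "x * c"] by (simp add: star_mult mult.assoc)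
qed

end

section \<open>States\<close>

text \<open>With \<open>h = x x\<^sup>* + y y\<^sup>*\<close> and \<open>g = \<delta>\<^sup>2 (\<delta>\<^sup>2 + h)\<^sup>-\<^sup>1\<close> in the unitization, \<open>e = 1 - g\<close> has scalar part
  \<open>0\<close>, and \<open>\<parallel>x - e x\<parallel>\<^sup>2 = \<parallel>g x x\<^sup>* g\<parallel> \<le> \<parallel>g h g\<parallel> \<le> \<delta>\<^sup>2\<close>.\<close>
lemma approximate_unit:
  fixes x y :: "'a::cstar_algebra"
  assumes "0 < \<delta>"
  obtains e where "star e = e" "norm e \<le> 1" "norm (x - e * x) \<le> \<delta>" "norm (y - e * y) \<le> \<delta>"
proof -
  define X Y where "X = Unitize x 0" and "Y = Unitize y 0"
  define h where "h = X * star X + Y * star Y"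
  have pXX: "pos (Z * star Z)" for Z :: "'a unitization"
    using pos_star_mult[of "star Z"] by (simp add: star_star)
  then have h: "pos h" unfolding h_def by (intro pos_add)
  obtain g where g: "pos g" "pos (1 - g)" "h * g = \<delta>\<^sup>2 *\<^sub>R (1 - g)" "pos (\<delta>\<^sup>2 *\<^sub>R 1 - g * h * g)"
    using resolvent[OF h, of "\<delta>\<^sup>2"] assms by (metis zero_less_power)
  have sg: "star g = g" using g by (simp add: pos_sa)
  have s0: "scal (1 - g) = 0"
    using arg_cong[OF g(3), of scal] assms by (simp add: h_def X_def Y_def)
  define e where "e = alg (1 - g)"
  have e: "1 - g = Unitize e 0" using s0 by (intro unitization_eqI) (simp_all add: e_def)
  have se: "star e = e" using arg_cong[OF sg, of alg] by (simp add: e_def star_simps)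
  have "norm (1 - g) \<le> 1" using norm_mono_pos[OF g(2), of 1] g(1) norm_1_le[where 'a = "'a unitization"] by simp
  then have ne: "norm e \<le> 1" unfolding e norm_Unitize_0 .
  have gXg: "g * (Z * star Z) * g = star (star Z * g) * (star Z * g)" for Z
    by (simp add: star_simps sg mult.assoc)
  have gZ: "norm (g * Z) \<le> \<delta>" if "pos (g * h * g - g * (Z * star Z) * g)" for Z
  proof -
    have "(norm (g * Z))\<^sup>2 = norm (g * (Z * star Z) * g)"
      using norm_self_mult_star[of "g * Z"] by (simp add: star_simps sg mult.assoc)
    also have "\<dots> \<le> norm (g * h * g)"
      by (rule norm_mono_pos[OF _ that]) (unfold gXg, rule pos_star_mult)
    also have "\<dots> \<le> \<delta>\<^sup>2"
      using pos_conj[OF h, of g] g(4) by (intro norm_le_of_pos_diff) (simp_all add: sg)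
    finally show ?thesis by (rule power2_le_imp_le) (use assms in simp)
  qed
  have "g * X = Unitize (x - e * x) 0" "g * Y = Unitize (y - e * y) 0"
    using s0 by (auto intro!: unitization_eqI simp: X_def Y_def e_def)
  moreover have "norm (g * X) \<le> \<delta>"
    using gXg[of Y] pos_star_mult[of "star Y * g"] by (intro gZ) (simp add: h_def algebra_simps)
  moreover have "norm (g * Y) \<le> \<delta>"
    using gXg[of X] pos_star_mult[of "star X * g"] by (intro gZ) (simp add: h_def algebra_simps)
  ultimately show thesis using that[OF se ne] by (simp add: norm_Unitize_0)
qed

lemma state_positive_functional: "\<tau> \<in> states \<Longrightarrow> positive_functional (blinfun_apply \<tau>)"
  unfolding positive_functional_def states_def cstar_dual_def cstar_positive_def
  by (auto simp: blinfun.add_right)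

lemma state_norm_le: "\<tau> \<in> states \<Longrightarrow> cmod (blinfun_apply \<tau> x) \<le> norm x"
  using norm_blinfun[of \<tau> x] by (simp add: states_def)

text \<open>If \<open>\<tau>\<close> nearly attains its norm \<open>1\<close> at a contraction \<open>x\<close> and \<open>e x\<close> is close to \<open>x\<close>, then the
  Cauchy--Schwarz inequality \<open>\<bar>\<tau> (e x)\<bar>\<^sup>2 \<le> \<tau> (x\<^sup>* x) \<tau> (e\<^sup>2)\<close> forces \<open>\<tau> (e\<^sup>2)\<close> to be close to \<open>1\<close>.\<close>
lemma state_approximate_unit:
  fixes a :: "'a::cstar_algebra"
  assumes t: "\<tau> \<in> states" and \<epsilon>: "0 < \<epsilon>"
  obtains e where "star e = e" "norm e \<le> 1" "norm (a - e * a) \<le> \<epsilon>"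
    "1 - \<epsilon> \<le> Re (blinfun_apply \<tau> (e * e))"
proof -
  define \<delta> where "\<delta> = min \<epsilon> 1 / 4"
  have d: "0 < \<delta>" "\<delta> \<le> \<epsilon> / 4" "\<delta> \<le> 1/4" using \<epsilon> by (auto simp: \<delta>_def min_def)
  have "\<not> (\<forall>x. norm (blinfun_apply \<tau> x) \<le> (1 - \<delta>) * norm x)"
  proof
    assume "\<forall>x. norm (blinfun_apply \<tau> x) \<le> (1 - \<delta>) * norm x"
    then have "norm \<tau> \<le> 1 - \<delta>" using d by (intro norm_blinfun_bound) auto
    then show False using t d by (simp add: states_def)
  qed
  then obtain x0 where x0: "(1 - \<delta>) * norm x0 < cmod (blinfun_apply \<tau> x0)" by (auto simp: not_le)
  then have "x0 \<noteq> 0" by auto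
  define x where "x = (1 / norm x0) *\<^sub>R x0"
  have x: "norm x \<le> 1" "1 - \<delta> < cmod (blinfun_apply \<tau> x)"
    using x0 \<open>x0 \<noteq> 0\<close> by (simp_all add: x_def blinfun.scaleR_right field_simps)
  obtain e where e: "star e = e" "norm e \<le> 1" "norm (a - e * a) \<le> \<delta>" "norm (x - e * x) \<le> \<delta>"
    using approximate_unit[OF d(1)] by metis
  have pf: "positive_functional (blinfun_apply \<tau>)" by (rule state_positive_functional[OF t])
  have "cmod (blinfun_apply \<tau> (x - e * x)) \<le> \<delta>" using state_norm_le[OF t] e(4) order_trans by blast
  then have "cmod (blinfun_apply \<tau> x) - cmod (blinfun_apply \<tau> (e * x)) \<le> \<delta>"
    unfolding blinfun.diff_right using norm_triangle_ineq2 order_trans by blast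
  then have "1 - 2 * \<delta> \<le> cmod (blinfun_apply \<tau> (e * x))" using x by simp
  then have "(1 - 2 * \<delta>)\<^sup>2 \<le> (cmod (blinfun_apply \<tau> (e * x)))\<^sup>2" using d by (intro power_mono) auto
  also have "\<dots> \<le> Re (blinfun_apply \<tau> (star x * x)) * Re (blinfun_apply \<tau> (e * e))"
    using cauchy_schwarz[OF pf, of e x] e(1) by simp
  also have "\<dots> \<le> 1 * Re (blinfun_apply \<tau> (e * e))"
  proof (rule mult_right_mono)
    have "cmod (blinfun_apply \<tau> (star x * x)) \<le> 1"
      using state_norm_le[OF t, of "star x * x"] x(1) by (simp add: norm_star_mult_self power_le_one order_trans)
    then show "Re (blinfun_apply \<tau> (star x * x)) \<le> 1" using complex_Re_le_cmod order_trans by blast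
    show "0 \<le> Re (blinfun_apply \<tau> (e * e))"
      using pf_star_mult[OF pf, of e] e(1) by (simp add: complex_nonneg_Reals_iff)
  qed
  finally have "(1 - 2 * \<delta>)\<^sup>2 \<le> Re (blinfun_apply \<tau> (e * e))" by simp
  moreover have "1 - \<epsilon> \<le> (1 - 2 * \<delta>)\<^sup>2"
  proof -
    have "(1 - 2 * \<delta>)\<^sup>2 = 1 - 4 * \<delta> + 4 * (\<delta> * \<delta>)" by (simp add: power2_eq_square algebra_simps)
    then show ?thesis using d zero_le_square[of \<delta>] by linarith
  qed
  ultimately show thesis using e d by (intro that) auto
qed

definition state_ext :: "('a::cstar_algebra \<Rightarrow>\<^sub>L complex) \<Rightarrow> 'a unitization \<Rightarrow> complex"
  where "state_ext \<tau> z = blinfun_apply \<tau> (alg z) + scal z"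

lemma state_ext_Unitize [simp]: "state_ext \<tau> (Unitize a 0) = blinfun_apply \<tau> a"
  by (simp add: state_ext_def)

lemma state_ext_1 [simp]: "state_ext \<tau> 1 = 1"
  by (simp add: state_ext_def blinfun.zero_right)

text \<open>Positivity at \<open>z\<^sup>* z\<close>, \<open>z = a + \<lambda>\<close>, holds in the limit: the element \<open>e z\<close> belongs to the algebra, and
  \<open>\<tau> ((e z)\<^sup>* (e z))\<close> tends to the required value along an approximate unit.\<close>
lemma state_ext_positive:
  fixes \<tau> :: "'a::cstar_algebra \<Rightarrow>\<^sub>L complex"
  assumes t: "\<tau> \<in> states"
  shows "positive_functional (state_ext \<tau>)"
  unfolding positive_functional_def
proof (intro conjI allI)
  have sC: "blinfun_apply \<tau> (c *\<^sub>C x) = c * blinfun_apply \<tau> x" for c x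
    using t by (simp add: states_def cstar_dual_def)
  fix z w :: "'a unitization" and c
  show "state_ext \<tau> (z + w) = state_ext \<tau> z + state_ext \<tau> w"
    by (simp add: state_ext_def blinfun.add_right)
  show "state_ext \<tau> (c *\<^sub>C z) = c * state_ext \<tau> z"
    by (simp add: state_ext_def sC algebra_simps)
  define a l where "a = alg z" and "l = scal z"
  define M where "M = 2 * norm a + 4 * cmod l + (cmod l)\<^sup>2 + 1"
  have approx: "\<exists>v\<in>\<real>\<^sub>\<ge>\<^sub>0. dist v (state_ext \<tau> (star z * z)) < \<epsilon> * M" if "0 < \<epsilon>" for \<epsilon>
  proof -
    obtain e where e: "star e = e" "norm e \<le> 1" "norm (a - e * a) \<le> \<epsilon>"
      "1 - \<epsilon> \<le> Re (blinfun_apply \<tau> (e * e))"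
      using state_approximate_unit[OF t \<open>0 < \<epsilon>\<close>] by metis
    define b where "b = a - e * (e * a)"
    have nb: "norm b \<le> 2 * \<epsilon>"
    proof -
      have "b = (a - e * a) + e * (a - e * a)" by (simp add: b_def algebra_simps)
      then have "norm b \<le> norm (a - e * a) + norm e * norm (a - e * a)"
        by (metis add_left_mono norm_mult_ineq norm_triangle_le)
      moreover have "norm e * norm (a - e * a) \<le> 1 * \<epsilon>" using e that by (intro mult_mono) auto
      ultimately show ?thesis using e by simp
    qed
    define u where "u = e * a + l *\<^sub>C e"
    have eq: "state_ext \<tau> (star z * z) - blinfun_apply \<tau> (star u * u) =
        blinfun_apply \<tau> (star a * b) + cnj l * blinfun_apply \<tau> b + l * blinfun_apply \<tau> (star b)
        + cnj l * l * (1 - blinfun_apply \<tau> (e * e))"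
      by (simp add: state_ext_def u_def b_def e(1) star_simps a_def[symmetric] l_def[symmetric]
          algebra_simps sC blinfun.add_right blinfun.diff_right scaleC_mult_left scaleC_mult_right scaleC_scaleC)
    have i: "Im (blinfun_apply \<tau> (e * e)) = 0" "Re (blinfun_apply \<tau> (e * e)) \<le> 1"
      using pf_star_mult[OF state_positive_functional[OF t], of e] e(1,2) state_norm_le[OF t, of "e * e"]
        norm_mult_ineq[of e e] mult_le_one[OF e(2) norm_ge_zero e(2)] complex_Re_le_cmod[of "blinfun_apply \<tau> (e * e)"]
      by (auto simp: complex_nonneg_Reals_iff)
    then have "1 - blinfun_apply \<tau> (e * e) = of_real (1 - Re (blinfun_apply \<tau> (e * e)))"
      by (simp add: complex_eq_iff)
    then have "cmod (1 - blinfun_apply \<tau> (e * e)) = 1 - Re (blinfun_apply \<tau> (e * e))"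
      using i by (simp only: norm_of_real)
    then have 4: "cmod (cnj l * l * (1 - blinfun_apply \<tau> (e * e))) \<le> (cmod l)\<^sup>2 * \<epsilon>"
      using e(4) by (simp add: norm_mult power2_eq_square mult_left_mono)
    have 1: "cmod (blinfun_apply \<tau> (star a * b)) \<le> norm a * (2 * \<epsilon>)"
      using state_norm_le[OF t, of "star a * b"] norm_mult_ineq[of "star a" b]
        mult_left_mono[OF nb, of "norm a"] by simp
    have 2: "cmod (cnj l * blinfun_apply \<tau> b) \<le> cmod l * (2 * \<epsilon>)"
      using state_norm_le[OF t, of b] nb by (simp add: norm_mult mult_left_mono)
    have 3: "cmod (l * blinfun_apply \<tau> (star b)) \<le> cmod l * (2 * \<epsilon>)"
      using state_norm_le[OF t, of "star b"] nb by (simp add: norm_mult mult_left_mono)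
    have "cmod (state_ext \<tau> (star z * z) - blinfun_apply \<tau> (star u * u))
        \<le> norm a * (2 * \<epsilon>) + cmod l * (2 * \<epsilon>) + cmod l * (2 * \<epsilon>) + (cmod l)\<^sup>2 * \<epsilon>"
      unfolding eq by (intro norm_triangle_mono 1 2 3 4)
    also have "\<dots> < \<epsilon> * M" using that by (simp add: M_def algebra_simps)
    finally show ?thesis using pf_star_mult[OF state_positive_functional[OF t], of u]
      by (auto simp: dist_norm norm_minus_commute)
  qed
  have M: "M > 0" unfolding M_def by (intro add_nonneg_pos add_nonneg_nonneg) auto
  have "closed (\<real>\<^sub>\<ge>\<^sub>0 :: complex set)" by (rule closed_nonneg_Reals_complex)
  then show "state_ext \<tau> (star z * z) \<in> \<real>\<^sub>\<ge>\<^sub>0"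
  proof (rule closed_approachable[THEN iffD1], intro allI impI)
    fix \<epsilon> :: real assume "0 < \<epsilon>"
    then show "\<exists>v\<in>\<real>\<^sub>\<ge>\<^sub>0. dist v (state_ext \<tau> (star z * z)) < \<epsilon>"
      using approx[of "\<epsilon> / M"] M by simp
  qed
qed

section \<open>The Hahn--Banach theorem\<close>

text \<open>Homogeneity is stated as an inequality, which is easier to verify for infima and implies equality by
  rescaling (\<open>sublinear_scaleR\<close>).\<close>
definition sublinear :: "('v::real_vector \<Rightarrow> real) \<Rightarrow> bool"
  where "sublinear q \<longleftrightarrow> (\<forall>x y. q (x + y) \<le> q x + q y) \<and> (\<forall>t>0. \<forall>x. q (t *\<^sub>R x) \<le> t * q x)"

lemma sublinear_add: "sublinear q \<Longrightarrow> q (x + y) \<le> q x + q y"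
  by (simp add: sublinear_def)

lemma sublinear_0: assumes "sublinear q" shows "q 0 = 0"
proof -
  have "q ((1/2) *\<^sub>R 0) \<le> (1/2) * q 0" "q (0 + 0) \<le> q 0 + q 0"
    using assms by (auto simp only: sublinear_def) 
  then show ?thesis by simp
qed

lemma sublinear_scaleR: assumes "sublinear q" "0 \<le> t" shows "q (t *\<^sub>R x) = t * q x"
proof (cases "t = 0")
  case False
  then have t: "t > 0" using assms by simp
  then have "q ((1/t) *\<^sub>R (t *\<^sub>R x)) \<le> (1/t) * q (t *\<^sub>R x)" "q (t *\<^sub>R x) \<le> t * q x"
    using assms(1) zero_less_divide_1_iff[of t] unfolding sublinear_def by blast+
  then show ?thesis using t by (simp add: field_simps)
qed (use sublinear_0[OF assms(1)] in simp)

lemma sublinear_neg: assumes "sublinear q" shows "- q (- x) \<le> q x"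
  using sublinear_add[OF assms, of x "-x"] sublinear_0[OF assms] by simp

text \<open>The largest sublinear functional below \<open>q\<close> whose value at \<open>- y\<close> is at most \<open>- q y\<close>; a linear functional
  below it therefore agrees with \<open>q\<close> at \<open>y\<close>.\<close>
definition tilt :: "('v::real_vector \<Rightarrow> real) \<Rightarrow> 'v \<Rightarrow> 'v \<Rightarrow> real"
  where "tilt q y x = (INF t\<in>{0..}. q (x + t *\<^sub>R y) - t * q y)"

lemma tilt_le:
  assumes "sublinear q" "0 \<le> t"
  shows "tilt q y x \<le> q (x + t *\<^sub>R y) - t * q y"
  unfolding tilt_def
proof (rule cINF_lower)
  show "bdd_below ((\<lambda>t. q (x + t *\<^sub>R y) - t * q y) ` {0..})"
  proof (rule bdd_belowI2[where m = "- q (- x)"])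
    fix s :: real assume "s \<in> {0..}"
    then show "- q (- x) \<le> q (x + s *\<^sub>R y) - s * q y"
      using sublinear_add[OF assms(1), of "x + s *\<^sub>R y" "- x"] sublinear_scaleR[OF assms(1), of s y] by simp
  qed
qed (use assms in simp)

lemma le_tilt: "(\<And>t. 0 \<le> t \<Longrightarrow> c \<le> q (x + t *\<^sub>R y) - t * q y) \<Longrightarrow> c \<le> tilt q y x"
  unfolding tilt_def by (rule cINF_greatest) auto

lemma sublinear_tilt:
  assumes q: "sublinear q" shows "sublinear (tilt q y)"
  unfolding sublinear_def
proof (intro conjI allI impI)
  fix x z
  have "tilt q y (x + z) - (q (x + s *\<^sub>R y) - s * q y) \<le> q (z + t *\<^sub>R y) - t * q y"
    if "0 \<le> s" "0 \<le> t" for s t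
    using tilt_le[OF q, of "s + t" y "x + z"] sublinear_add[OF q, of "x + s *\<^sub>R y" "z + t *\<^sub>R y"] that
    by (simp add: algebra_simps)
  then have "tilt q y (x + z) - (q (x + s *\<^sub>R y) - s * q y) \<le> tilt q y z" if "0 \<le> s" for s
    using that by (intro le_tilt) auto
  then have "tilt q y (x + z) - tilt q y z \<le> tilt q y x"
    by (intro le_tilt) (simp add: algebra_simps)
  then show "tilt q y (x + z) \<le> tilt q y x + tilt q y z" by simp
next
  fix s :: real and x assume s: "0 < s"
  have "tilt q y (s *\<^sub>R x) / s \<le> q (x + t *\<^sub>R y) - t * q y" if "0 \<le> t" for t
    using tilt_le[OF q, of "s * t" y "s *\<^sub>R x"] sublinear_scaleR[OF q, of s "x + t *\<^sub>R y"] that s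
    by (simp add: algebra_simps divide_simps)
  then have "tilt q y (s *\<^sub>R x) / s \<le> tilt q y x" by (rule le_tilt)
  then show "tilt q y (s *\<^sub>R x) \<le> s * tilt q y x" using s by (simp add: field_simps)
qed

lemma minimal_sublinear_exists:
  fixes p :: "'v::real_vector \<Rightarrow> real"
  assumes p: "sublinear p"
  obtains q where "sublinear q" "q \<le> p" "\<And>r. sublinear r \<Longrightarrow> r \<le> q \<Longrightarrow> r = q"
proof -
  define A where "A = {q. sublinear q \<and> q \<le> p}"
  have "\<exists>m\<in>A. \<forall>a\<in>A. a \<le> m \<longrightarrow> a = m"
  proof (rule predicate_Zorn)
    show "partial_order_on A (relation_of (\<lambda>q r. r \<le> q) A)"
      by (auto simp: partial_order_on_def preorder_on_def relation_of_def refl_on_def trans_def antisym_def)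
    show "\<exists>u\<in>A. \<forall>a\<in>C. u \<le> a" if C: "C \<in> Chains (relation_of (\<lambda>q r. r \<le> q) A)" for C
    proof (cases "C = {}")
      case True
      then show ?thesis using p by (auto simp: A_def)
    next
      case False
      have CA: "C \<subseteq> A" using C by (auto simp: Chains_def relation_of_def)
      have chain: "q \<le> r \<or> r \<le> q" if "q \<in> C" "r \<in> C" for q r
        using C that by (auto simp: Chains_def relation_of_def)
      define u where "u x = (INF q\<in>C. q x)" for x
      have low: "u x \<le> q x" if "q \<in> C" for q x
        unfolding u_def
      proof (rule cINF_lower[OF _ that])
        show "bdd_below ((\<lambda>q. q x) ` C)"
        proof (rule bdd_belowI2[where m = "- p (- x)"])
          fix r assume "r \<in> C"
          then have "sublinear r" "r (- x) \<le> p (- x)" using CA by (auto simp: A_def le_fun_def)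
          then show "- p (- x) \<le> r x" using sublinear_neg[of r x] by simp
        qed
      qed
      have great: "c \<le> u x" if "\<And>q. q \<in> C \<Longrightarrow> c \<le> q x" for c x
        unfolding u_def using False that by (intro cINF_greatest) auto
      have "sublinear u"
        unfolding sublinear_def
      proof (intro conjI allI impI)
        fix x y
        have "u (x + y) - q x \<le> r y" if qr: "q \<in> C" "r \<in> C" for q r
        proof -
          obtain m where m: "m \<in> C" "m \<le> q" "m \<le> r" using chain[OF qr] qr by auto
          then have "m (x + y) \<le> m x + m y" using CA by (auto simp: A_def sublinear_def)
          then show ?thesis using low[OF m(1), of "x + y"] m(2,3)[THEN le_funD] 
            by (smt (verit))
        qed
        then have "u (x + y) - q x \<le> u y" if "q \<in> C" for q using that by (intro great) auto
        then have "u (x + y) - u y \<le> u x" by (intro great) (simp add: algebra_simps)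
        then show "u (x + y) \<le> u x + u y" by simp
      next
        fix t :: real and x assume t: "0 < t"
        have "u (t *\<^sub>R x) / t \<le> q x" if "q \<in> C" for q
        proof -
          have "q (t *\<^sub>R x) \<le> t * q x" using that CA t by (auto simp: A_def sublinear_def)
          then show ?thesis using low[OF that, of "t *\<^sub>R x"] t by (simp add: field_simps)
        qed
        then have "u (t *\<^sub>R x) / t \<le> u x" by (intro great) auto
        then show "u (t *\<^sub>R x) \<le> t * u x" using t by (simp add: field_simps)
      qed
      moreover have "u \<le> p"
      proof -
        obtain q where "q \<in> C" using False by blast
        then have "q \<le> p" "u \<le> q" using CA low by (auto simp: A_def le_fun_def)
        then show ?thesis by (rule order_trans[rotated])
      qed
      ultimately show ?thesis using low by (auto simp: A_def le_fun_def)
    qed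
  qed
  then obtain q where q: "q \<in> A" "\<forall>a\<in>A. a \<le> q \<longrightarrow> a = q" by blast
  show thesis
  proof (rule that)
    show "sublinear q" "q \<le> p" using q by (auto simp: A_def)
    show "r = q" if "sublinear r" "r \<le> q" for r
      using that q by (auto simp: A_def intro: order_trans)
  qed
qed

text \<open>A minimal sublinear functional \<open>f\<close> coincides with each of its tilts, so \<open>f (- y) = - f y\<close> for all \<open>y\<close>, and
  a sublinear functional with this property is linear. Starting below the tilt of \<open>p\<close> at \<open>x0\<close> fixes
  the value at \<open>x0\<close>.\<close>
theorem hahn_banach:
  fixes p :: "'v::real_vector \<Rightarrow> real"
  assumes p: "sublinear p"
  obtains f where "linear f" "\<And>x. f x \<le> p x" "f x0 = p x0"
proof -
  obtain f where f: "sublinear f" "f \<le> tilt p x0" and min: "\<And>r. sublinear r \<Longrightarrow> r \<le> f \<Longrightarrow> r = f"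
    using minimal_sublinear_exists[OF sublinear_tilt[OF p]] by metis
  have "tilt f y = f" for y
    using tilt_le[OF f(1), of 0] by (intro min sublinear_tilt f(1)) (simp add: le_fun_def)
  then have neg: "f (- y) = - f y" for y
    using tilt_le[OF f(1), of 1 y "- y"] sublinear_neg[OF f(1), of y] sublinear_0[OF f(1)] by simp
  have fp: "f x \<le> p x" for x
    using f(2)[THEN le_funD, of x] tilt_le[OF p, of 0 x0 x] by simp
  have "linear f"
  proof (rule linearI)
    fix x y
    show "f (x + y) = f x + f y"
      using sublinear_add[OF f(1), of x y] sublinear_add[OF f(1), of "x + y" "- y"] neg by simp
  next
    fix c x
    show "f (c *\<^sub>R x) = c *\<^sub>R f x"
      using sublinear_scaleR[OF f(1), of c x] sublinear_scaleR[OF f(1), of "- c" x] neg[of "c *\<^sub>R x"]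
      by (cases "0 \<le> c") auto
  qed
  moreover have "f x0 = p x0"
    using f(2)[THEN le_funD, of "- x0"] tilt_le[OF p, of 1 x0 "- x0"] neg[of x0] sublinear_0[OF p] fp[of x0]
    by simp
  ultimately show thesis using that fp by blast
qed

section \<open>Excision of pure states\<close>

definition real_part :: "'a::cstar_algebra \<Rightarrow> 'a"
  where "real_part x = (1/2) *\<^sub>R (x + star x)"

lemma real_part_sa: "star x = x \<Longrightarrow> real_part x = x"
  by (simp add: real_part_def flip: scaleR_2)

lemma star_real_part: "star (real_part x) = real_part x"
  by (simp add: real_part_def star_simps add.commute)

lemma norm_real_part_le: "norm (real_part x) \<le> norm x"
  using norm_triangle_ineq[of x "star x"] by (simp add: real_part_def)

lemma normalized_state:
  fixes \<sigma> :: "'a::cstar_algebra \<Rightarrow>\<^sub>L complex"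
  assumes "positive_functional (blinfun_apply \<sigma>)" "norm \<sigma> = s" "0 < s"
  shows "(1/s) *\<^sub>R \<sigma> \<in> states"
  using assms pf_star_mult[OF assms(1)] pf_scaleC[OF assms(1)]
  by (auto simp: states_def cstar_dual_def cstar_positive_def blinfun.scaleR_left complex_nonneg_Reals_iff)

text \<open>Extremality in the form of a Radon--Nikodym statement. The two functionals restrict to the algebra
  with norms at most \<open>s = \<phi> 1\<close> and \<open>1 - s\<close>; since their sum has norm \<open>1\<close>, both bounds are attained, and
  \<open>\<tau>\<close> is the convex combination of the two normalized restrictions with weights \<open>s\<close> and \<open>1 - s\<close>.\<close>
lemma pure_state_proportional:
  fixes \<tau> :: "'a::cstar_algebra \<Rightarrow>\<^sub>L complex"
  assumes t: "\<tau> \<in> pure_states"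
    and \<phi>: "positive_functional \<phi>" and \<psi>: "positive_functional (\<lambda>z. state_ext \<tau> z - \<phi> z)"
  shows "\<phi> z = of_real (Re (\<phi> 1)) * state_ext \<tau> z"
proof -
  have ts: "\<tau> \<in> states" using t by (simp add: pure_states_def extreme_point_of_def)
  define s where "s = Re (\<phi> 1)"
  have s: "0 \<le> s" "s \<le> 1" using pf_one_ge_0[OF \<phi>] pf_one_ge_0[OF \<psi>] by (simp_all add: s_def)
  have bphi: "cmod (\<phi> z) \<le> s * norm z" for z using pf_norm_le[OF \<phi>] by (simp add: s_def)
  have bpsi: "cmod (state_ext \<tau> z - \<phi> z) \<le> (1 - s) * norm z" for z
    using pf_norm_le[OF \<psi>, of z] by (simp add: s_def)
  show ?thesis unfolding s_def[symmetric]
  proof (cases "s = 0 \<or> s = 1")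
    case True
    then show "\<phi> z = of_real s * state_ext \<tau> z" using bphi[of z] bpsi[of z] by auto
  next
    case False
    then have s: "0 < s" "s < 1" using s by auto
    define \<phi>' where "\<phi>' = Blinfun (\<lambda>a. \<phi> (Unitize a 0))"
    have bl: "bounded_linear (\<lambda>a. \<phi> (Unitize a 0))"
      by (rule bounded_linear_intro[where K = s])
        (use bphi[of "Unitize _ 0"] in \<open>auto simp: Unitize_0_simps pf_add[OF \<phi>] pf_scaleR[OF \<phi>] scaleR_conv_of_real norm_Unitize_0 mult.commute\<close>)
    have ap: "blinfun_apply \<phi>' a = \<phi> (Unitize a 0)" for a
      by (simp add: \<phi>'_def bounded_linear_Blinfun_apply[OF bl])
    have n1: "norm \<phi>' \<le> s"
      by (rule norm_blinfun_bound) (use s bphi[of "Unitize _ 0"] in \<open>auto simp: ap norm_Unitize_0\<close>)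
    have n2: "norm (\<tau> - \<phi>') \<le> 1 - s"
      by (rule norm_blinfun_bound) (use s bpsi[of "Unitize _ 0"] in \<open>auto simp: ap norm_Unitize_0 blinfun.diff_left\<close>)
    have "norm \<tau> = 1" using ts by (simp add: states_def)
    then have n: "norm \<phi>' = s" "norm (\<tau> - \<phi>') = 1 - s"
      using n1 n2 norm_triangle_ineq[of \<phi>' "\<tau> - \<phi>'"] by simp_all
    have "positive_functional (blinfun_apply \<phi>')"
      using pf_add[OF \<phi>] pf_scaleC[OF \<phi>] pf_star_mult[OF \<phi>]
      by (simp add: positive_functional_def ap Unitize_0_simps)
    then have "(1/s) *\<^sub>R \<phi>' \<in> states" using n(1) s(1) by (rule normalized_state)
    moreover have "positive_functional (blinfun_apply (\<tau> - \<phi>'))"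
      using pf_add[OF \<psi>, of "Unitize _ 0" "Unitize _ 0"] pf_scaleC[OF \<psi>, of _ "Unitize _ 0"]
        pf_star_mult[OF \<psi>, of "Unitize _ 0"]
      by (simp add: positive_functional_def blinfun.diff_left ap flip: Unitize_0_simps)
    then have "(1/(1 - s)) *\<^sub>R (\<tau> - \<phi>') \<in> states" using n(2) s(2) by (intro normalized_state) auto
    ultimately have ne: "\<tau> \<notin> open_segment ((1/(1 - s)) *\<^sub>R (\<tau> - \<phi>')) ((1/s) *\<^sub>R \<phi>')"
      using t by (simp add: pure_states_def extreme_point_of_def)
    have "\<tau> = (1 - s) *\<^sub>R ((1/(1 - s)) *\<^sub>R (\<tau> - \<phi>')) + s *\<^sub>R ((1/s) *\<^sub>R \<phi>')" using s by simp
    then have eq: "(1/(1 - s)) *\<^sub>R (\<tau> - \<phi>') = (1/s) *\<^sub>R \<phi>'"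
      using ne s unfolding in_segment by blast
    have "\<tau> - \<phi>' = (1 - s) *\<^sub>R ((1/s) *\<^sub>R \<phi>')" unfolding eq[symmetric] using s by simp
    then have "s *\<^sub>R (\<tau> - \<phi>') = (1 - s) *\<^sub>R \<phi>'" using s by simp
    then have p: "\<phi>' = s *\<^sub>R \<tau>" by (simp add: algebra_simps)
    have Im1: "Im (\<phi> 1) = 0" using pf_pos(2)[OF \<phi>, of 1] by simp
    have "z = Unitize (alg z) 0 + scal z *\<^sub>C 1" by (auto intro!: unitization_eqI)
    then have "\<phi> z = blinfun_apply \<phi>' (alg z) + scal z * \<phi> 1"
      by (metis ap pf_add[OF \<phi>] pf_scaleC[OF \<phi>])
    moreover have "\<phi> 1 = of_real s" using Im1 by (simp add: s_def complex_eq_iff)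
    ultimately show "\<phi> z = of_real s * state_ext \<tau> z"
      by (simp add: p state_ext_def blinfun.scaleR_left scaleR_conv_of_real algebra_simps)
  qed
qed

text \<open>The infimum of \<open>\<tau> h\<close> over the positive \<open>h \<ge> y\<close> is \<open>\<phi> y\<close> for some functional \<open>0 \<le> \<phi> \<le> \<tau>\<close>. By purity \<open>\<phi>\<close>
  is a nonnegative multiple of \<open>\<tau>\<close>, and the infimum is therefore not positive.\<close>
lemma pure_state_majorant:
  fixes \<tau> :: "'a::cstar_algebra \<Rightarrow>\<^sub>L complex"
  assumes t: "\<tau> \<in> pure_states" and sy: "star y = y" and y: "Re (state_ext \<tau> y) \<le> 0" and \<delta>: "0 < \<delta>"
  obtains h where "pos h" "pos (h - y)" "Re (state_ext \<tau> h) < \<delta>"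
proof -
  have ts: "\<tau> \<in> states" using t by (simp add: pure_states_def extreme_point_of_def)
  define T where "T = state_ext \<tau>"
  have T: "positive_functional T" unfolding T_def by (rule state_ext_positive[OF ts])
  define H where "H x = {h. pos h \<and> pos (h - real_part x)}" for x :: "'a unitization"
  define p where "p x = (INF h\<in>H x. Re (T h))" for x
  have ne: "H x \<noteq> {}" for x
  proof -
    have "norm x *\<^sub>R 1 \<in> H x"
      unfolding H_def using norm_real_part_le[of x]
      by (auto intro!: pos_scaleR pos_norm_diff star_real_part)
    then show ?thesis by blast
  qed
  have low: "p x \<le> Re (T h)" if "h \<in> H x" for x h
    unfolding p_def
    by (rule cINF_lower[OF _ that], rule bdd_belowI2[where m = 0]) (auto simp: H_def pf_pos[OF T])
  have great: "c \<le> p x" if "\<And>h. h \<in> H x \<Longrightarrow> c \<le> Re (T h)" for c x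
    unfolding p_def using ne that by (intro cINF_greatest) auto
  have "sublinear p"
    unfolding sublinear_def
  proof (intro conjI allI impI)
    fix x z
    have "p (x + z) - Re (T h) \<le> Re (T k)" if "h \<in> H x" "k \<in> H z" for h k
    proof -
      have "(h + k) - real_part (x + z) = (h - real_part x) + (k - real_part z)"
        by (simp add: real_part_def star_add algebra_simps)
      moreover have "pos ((h - real_part x) + (k - real_part z))" "pos (h + k)"
        using that by (auto simp: H_def intro!: pos_add simp del: add_diff_eq diff_add_eq)
      ultimately have "h + k \<in> H (x + z)" by (auto simp only: H_def mem_Collect_eq)
      from low[OF this] show ?thesis by (simp add: pf_add[OF T])
    qed
    then have "p (x + z) - Re (T h) \<le> p z" if "h \<in> H x" for h using that by (intro great) auto
    then have "p (x + z) - p z \<le> p x" by (intro great) (simp add: algebra_simps)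
    then show "p (x + z) \<le> p x + p z" by simp
  next
    fix r :: real and x assume r: "0 < r"
    have "p (r *\<^sub>R x) / r \<le> Re (T h)" if "h \<in> H x" for h
    proof -
      have "r *\<^sub>R h - real_part (r *\<^sub>R x) = r *\<^sub>R (h - real_part x)"
        by (simp add: real_part_def star_scaleR algebra_simps)
      then have "r *\<^sub>R h \<in> H (r *\<^sub>R x)" using that r by (auto simp: H_def intro!: pos_scaleR)
      from low[OF this] show ?thesis using r by (simp add: pf_scaleR[OF T] field_simps)
    qed
    then have "p (r *\<^sub>R x) / r \<le> p x" by (intro great) auto
    then show "p (r *\<^sub>R x) \<le> r * p x" using r by (simp add: field_simps)
  qed
  then obtain f where f: "linear f" "\<And>x. f x \<le> p x" "f y = p y" using hahn_banach[where p = p and ?x0.0 = y] by metis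
  interpret f: linear f by (rule f(1))
  have f_le: "f x \<le> Re (T h)" if "h \<in> H x" for x h using f(2)[of x] low[OF that] by simp
  have f_sa: "f (\<i> *\<^sub>C k) = 0" if "star k = k" for k
  proof -
    have "real_part (\<i> *\<^sub>C k) = 0" "real_part (- (\<i> *\<^sub>C k)) = 0"
      using that by (simp_all add: real_part_def star_simps scaleC_minus_left)
    then have "0 \<in> H (\<i> *\<^sub>C k)" "0 \<in> H (- (\<i> *\<^sub>C k))" by (simp_all add: H_def)
    from this[THEN f_le] show ?thesis by (simp add: f.neg pf_0[OF T])
  qed
  have f_pos: "0 \<le> f h" "f h \<le> Re (T h)" if "pos h" for h
  proof -
    have "real_part h = h" "real_part (- h) = - h"
      using that by (simp_all add: real_part_sa star_minus pos_sa)
    then have "h \<in> H h" "0 \<in> H (- h)" using that by (simp_all add: H_def)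
    from this[THEN f_le] show "0 \<le> f h" "f h \<le> Re (T h)" by (simp_all add: f.neg pf_0[OF T])
  qed
  \<comment> \<open>The complex-linear functional with real part \<open>f\<close>.\<close>
  define \<phi> where "\<phi> x = Complex (f x) (- f (\<i> *\<^sub>C x))" for x
  have phi_add: "\<phi> (x + z) = \<phi> x + \<phi> z" for x z
    by (simp add: \<phi>_def scaleC_add_right f.add complex_eq_iff)
  have phi_scaleC: "\<phi> (c *\<^sub>C x) = c * \<phi> x" for c x
  proof -
    have "c *\<^sub>C x = Re c *\<^sub>R x + Im c *\<^sub>R (\<i> *\<^sub>C x)"
      unfolding scaleR_eq_scaleC scaleC_scaleC scaleC_add_left[symmetric]
      by (simp add: complex_eq[of c, symmetric] mult.commute)
    moreover have "\<i> *\<^sub>C (c *\<^sub>C x) = Re c *\<^sub>R (\<i> *\<^sub>C x) - Im c *\<^sub>R x"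
    proof -
      have "\<i> * c = of_real (Re c) * \<i> + of_real (- Im c)" by (simp add: complex_eq_iff)
      then show ?thesis
        unfolding scaleR_eq_scaleC scaleC_scaleC by (simp add: scaleC_diff_left)
    qed
    ultimately show ?thesis
      by (simp add: \<phi>_def f.add f.diff f.scale complex_eq_iff)
  qed
  have phi_sa: "\<phi> k = of_real (f k)" if "star k = k" for k
    using f_sa[OF that] by (simp add: \<phi>_def complex_eq_iff)
  have sq: "star (star x * x) = star x * x" for x :: "'a unitization" by (simp add: star_simps)
  have "positive_functional \<phi>"
    unfolding positive_functional_def
    using phi_add phi_scaleC f_pos(1)[OF pos_star_mult] phi_sa[OF sq]
    by (simp add: complex_nonneg_Reals_iff)
  moreover have "positive_functional (\<lambda>z. T z - \<phi> z)"
    unfolding positive_functional_def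
    using phi_add phi_scaleC f_pos(2)[OF pos_star_mult] phi_sa[OF sq] pf_sa[OF T sq]
    by (simp add: complex_nonneg_Reals_iff pf_add[OF T] pf_scaleC[OF T] algebra_simps)
  ultimately have "\<phi> y = of_real (Re (\<phi> 1)) * T y" and "positive_functional \<phi>"
    using pure_state_proportional[OF t] by (auto simp: T_def)
  then have "f y = Re (\<phi> 1) * Re (T y)" "0 \<le> Re (\<phi> 1)"
    using phi_sa[OF sy] pf_one_ge_0 by (auto simp: complex_eq_iff)
  then have "p y \<le> 0" using f(3) y by (simp add: T_def mult_nonneg_nonpos)
  then have "\<not> \<delta> \<le> p y" using \<delta> by simp
  then obtain h where "h \<in> H y" "Re (T h) < \<delta>" using great[of y \<delta>] not_le by blast
  then show thesis using that[of h] by (simp add: H_def T_def real_part_sa[OF sy])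
qed

lemma pure_imp_state: "\<tau> \<in> pure_states \<Longrightarrow> \<tau> \<in> states"
  by (simp add: pure_states_def extreme_point_of_def)

lemma pos_diff_square:
  fixes b :: "'a::{cstar_algebra,monoid_mult}"
  assumes "pos b" "pos (1 - b)" shows "pos (b - b * b)"
proof -
  have "pos (b * (1 - b))" using assms by (intro pos_commute_mult) (simp_all add: algebra_simps)
  then show ?thesis by (simp add: algebra_simps)
qed

lemma norm_le_one:
  fixes b :: "'a::{cstar_algebra,monoid_mult}"
  assumes "pos b" "pos (1 - b)" shows "norm b \<le> 1"
  using norm_le_of_pos_diff[OF assms(1), of 1] assms(2) by simp

lemma cauchy_schwarz_norm:
  fixes S :: "'a::{cstar_algebra,monoid_mult} \<Rightarrow> complex"
  assumes S: "positive_functional S" "S 1 = 1" and b: "pos b" "pos (1 - b)" "Re (S b) \<le> q"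
  shows "cmod (S (u * b)) \<le> norm u * sqrt q" "cmod (S (b * u)) \<le> norm u * sqrt q"
proof -
  have sb: "star b = b" using b by (simp add: pos_sa)
  have bb: "Re (S (b * b)) \<le> q"
    using pf_mono[OF S(1) pos_diff_square[OF b(1,2)]] b(3) by simp
  have main: "cmod (S (star v * b)) \<le> norm v * sqrt q" for v
  proof (rule power2_le_imp_le)
    have "(cmod (S (star v * b)))\<^sup>2 \<le> Re (S (b * b)) * Re (S (star v * v))"
      using cauchy_schwarz[OF S(1), of v b] by (simp add: sb)
    also have "\<dots> \<le> q * (norm v)\<^sup>2"
      using bb pf_square_le[OF S(1), of v] S(2) pf_star_mult[OF S(1), of b] pf_star_mult[OF S(1), of v]
      by (intro mult_mono) (auto simp: sb complex_nonneg_Reals_iff)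
    also have "\<dots> = (norm v * sqrt q)\<^sup>2"
      using b(3) pf_pos(1)[OF S(1) b(1)] by (simp add: power_mult_distrib)
    finally show "(cmod (S (star v * b)))\<^sup>2 \<le> (norm v * sqrt q)\<^sup>2" .
    show "0 \<le> norm v * sqrt q" using b(3) pf_pos(1)[OF S(1) b(1)] by simp
  qed
  show 1: "cmod (S (u * b)) \<le> norm u * sqrt q" for u using main[of "star u"] by (simp add: star_star)
  have "S (b * u) = cnj (S (star u * b))" using pf_star[OF S(1), of "star u * b"] by (simp add: star_simps sb)
  then show "cmod (S (b * u)) \<le> norm u * sqrt q" using 1[of "star u"] by simp
qed

text \<open>Take \<open>h \<ge> y\<close> with \<open>\<tau> h < \<epsilon> \<kappa>\<close> and \<open>b = h (\<kappa> + h)\<^sup>-\<^sup>1 = 1 - g\<close>. In \<open>y = g y g + b y + g y b\<close> the first term is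
  at most \<open>g h g \<le> \<kappa>\<close>, and the values of a state at the other two are bounded through the Cauchy--Schwarz inequality by
  \<open>\<parallel>y\<parallel> sqrt (\<sigma> b)\<close> each. The last inequality does not mention the uncontrolled norm of \<open>h\<close>.\<close>
lemma excision_one_element:
  fixes \<tau> :: "'a::cstar_algebra \<Rightarrow>\<^sub>L complex"
  assumes t: "\<tau> \<in> pure_states" and sy: "star y = y" and y: "Re (state_ext \<tau> y) \<le> 0"
    and e: "0 < \<epsilon>" and k: "0 < \<kappa>"
  obtains b where "pos b" "pos (1 - b)" "Re (state_ext \<tau> b) < \<epsilon>"
    "\<And>\<sigma>. \<sigma> \<in> states \<Longrightarrow> Re (state_ext \<sigma> y) \<le> \<kappa> + 2 * norm y * sqrt (Re (state_ext \<sigma> b))"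
proof -
  have T: "positive_functional (state_ext \<tau>)" using t by (intro state_ext_positive pure_imp_state)
  obtain h where h: "pos h" "pos (h - y)" "Re (state_ext \<tau> h) < \<epsilon> * \<kappa>"
    using pure_state_majorant[OF t sy y, of "\<epsilon> * \<kappa>"] e k by (metis mult_pos_pos)
  obtain g where g: "pos g" "pos (1 - g)" "pos ((1/\<kappa>) *\<^sub>R h - (1 - g))" "pos (\<kappa> *\<^sub>R 1 - g * h * g)"
    using resolvent[OF h(1) k] by metis
  have sg: "star g = g" using g by (simp add: pos_sa)
  define b where "b = 1 - g"
  have b: "pos b" "pos (1 - b)" using g by (simp_all add: b_def)
  have ng: "norm g \<le> 1" using g by (intro norm_le_one)
  show thesis
  proof (rule that[OF b])
    have "Re (state_ext \<tau> b) \<le> Re (state_ext \<tau> h) / \<kappa>"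
      using pf_mono[OF T g(3)] by (simp add: b_def pf_scaleR[OF T])
    also have "\<dots> < \<epsilon>" using h(3) k by (simp add: field_simps)
    finally show "Re (state_ext \<tau> b) < \<epsilon>" .
    fix \<sigma> :: "'a \<Rightarrow>\<^sub>L complex" assume "\<sigma> \<in> states"
    define S where "S = state_ext \<sigma>"
    have S: "positive_functional S" unfolding S_def by (rule state_ext_positive[OF \<open>\<sigma> \<in> states\<close>])
    have S1: "S 1 = 1" by (simp add: S_def)
    have "y = g * y * g + (b * y + (g * y) * b)" by (simp add: b_def algebra_simps)
    then have "Re (S y) = Re (S (g * y * g)) + (Re (S (b * y)) + Re (S ((g * y) * b)))"
      by (metis pf_add[OF S] plus_complex.sel(1))
    moreover have "Re (S (g * y * g)) \<le> \<kappa>"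
    proof -
      have "pos (g * h * g - g * y * g)" using pos_conj[OF h(2), of g] by (simp add: sg algebra_simps)
      then have "Re (S (g * y * g)) \<le> Re (S (g * h * g))" by (rule pf_mono[OF S])
      also have "\<dots> \<le> \<kappa>" using pf_mono[OF S g(4)] by (simp add: pf_scaleR[OF S] S1)
      finally show ?thesis .
    qed
    moreover have "Re (S (b * y)) \<le> norm y * sqrt (Re (S b))"
      using cauchy_schwarz_norm(2)[OF S S1 b order_refl, of y] complex_Re_le_cmod[of "S (b * y)"] by linarith
    moreover have "Re (S ((g * y) * b)) \<le> norm y * sqrt (Re (S b))"
    proof -
      have "norm (g * y) \<le> norm y"
        using norm_mult_ineq[of g y] mult_right_mono[OF ng, of "norm y"] by simp
      then have "norm (g * y) * sqrt (Re (S b)) \<le> norm y * sqrt (Re (S b))"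
        using pf_pos(1)[OF S b(1)] by (intro mult_right_mono) auto
      then show ?thesis
        using cauchy_schwarz_norm(1)[OF S S1 b order_refl, of "g * y"] complex_Re_le_cmod[of "S ((g * y) * b)"] by linarith
    qed
    ultimately show "Re (state_ext \<sigma> y) \<le> \<kappa> + 2 * norm y * sqrt (Re (state_ext \<sigma> b))"
      by (simp add: S_def)
  qed
qed

text \<open>The average of the elements excising the single \<open>y \<in> G\<close>. The essential point is that \<open>\<gamma>\<close> is chosen before \<open>\<epsilon>\<close>.\<close>
lemma excision_finite_set:
  fixes \<tau> :: "'a::cstar_algebra \<Rightarrow>\<^sub>L complex"
  assumes t: "\<tau> \<in> pure_states" and G: "finite G" "\<And>y. y \<in> G \<Longrightarrow> star y = y \<and> Re (state_ext \<tau> y) \<le> 0"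
    and r: "0 < r"
  obtains \<gamma> where "0 < \<gamma>"
    "\<And>\<epsilon>. 0 < \<epsilon> \<Longrightarrow> \<exists>b. pos b \<and> pos (1 - b) \<and> Re (state_ext \<tau> b) < \<epsilon> \<and>
      (\<forall>\<sigma>\<in>states. (\<exists>y\<in>G. r \<le> Re (state_ext \<sigma> y)) \<longrightarrow> \<gamma> \<le> Re (state_ext \<sigma> b))"
proof -
  define M where "M = 1 + (\<Sum>y\<in>G. norm y)"
  \<comment> \<open>One more than the cardinality, so that an empty \<open>G\<close> needs no special treatment.\<close>
  define n where "n = real (card G) + 1"
  have M: "M > 0" unfolding M_def by (simp add: add_pos_nonneg sum_nonneg)
  have n: "n > 0" by (simp add: n_def)
  define \<gamma> where "\<gamma> = (r / (4 * M))\<^sup>2 / n"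
  have T: "positive_functional (state_ext \<tau>)" using t by (intro state_ext_positive pure_imp_state)
  show thesis
  proof (rule that)
    show "0 < \<gamma>" using M n r by (simp add: \<gamma>_def)
    fix \<epsilon> :: real assume e: "0 < \<epsilon>"
    have "\<forall>y\<in>G. \<exists>b. pos b \<and> pos (1 - b) \<and> Re (state_ext \<tau> b) < \<epsilon> \<and>
        (\<forall>\<sigma>\<in>states. Re (state_ext \<sigma> y) \<le> r/2 + 2 * norm y * sqrt (Re (state_ext \<sigma> b)))"
    proof
      fix y assume "y \<in> G"
      with G(2) have "star y = y" "Re (state_ext \<tau> y) \<le> 0" by auto
      from excision_one_element[OF t this e, of "r/2"] r
      show "\<exists>b. pos b \<and> pos (1 - b) \<and> Re (state_ext \<tau> b) < \<epsilon> \<and>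
        (\<forall>\<sigma>\<in>states. Re (state_ext \<sigma> y) \<le> r/2 + 2 * norm y * sqrt (Re (state_ext \<sigma> b)))"
        by (metis half_gt_zero)
    qed
    then obtain B where B: "\<And>y. y \<in> G \<Longrightarrow> pos (B y)" "\<And>y. y \<in> G \<Longrightarrow> pos (1 - B y)"
      "\<And>y. y \<in> G \<Longrightarrow> Re (state_ext \<tau> (B y)) < \<epsilon>"
      "\<And>y \<sigma>. y \<in> G \<Longrightarrow> \<sigma> \<in> states \<Longrightarrow> Re (state_ext \<sigma> y) \<le> r/2 + 2 * norm y * sqrt (Re (state_ext \<sigma> (B y)))"
      by metis
    define b where "b = (1/n) *\<^sub>R (\<Sum>y\<in>G. B y)"
    have 1: "pos b" unfolding b_def using n by (intro pos_scaleR pos_sum G(1) B(1)) auto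
    have "(\<Sum>y\<in>G. 1 - B y) = real (card G) *\<^sub>R 1 - (\<Sum>y\<in>G. B y)"
      by (simp add: sum_subtractf sum_constant_scaleR)
    then have "n *\<^sub>R 1 - (\<Sum>y\<in>G. B y) = 1 + (\<Sum>y\<in>G. 1 - B y)"
      by (simp add: n_def scaleR_add_left)
    moreover have "1 - b = (1/n) *\<^sub>R (n *\<^sub>R 1 - (\<Sum>y\<in>G. B y))"
      using n by (simp add: b_def scaleR_diff_right)
    ultimately have "1 - b = (1/n) *\<^sub>R (1 + (\<Sum>y\<in>G. 1 - B y))" by simp
    then have 2: "pos (1 - b)" using n by (auto intro!: pos_scaleR pos_add pos_sum G(1) B(2))
    have "Re (state_ext \<tau> b) = (\<Sum>y\<in>G. Re (state_ext \<tau> (B y))) / n"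
      by (simp add: b_def pf_scaleR[OF T] pf_sum[OF T G(1)])
    also have "\<dots> \<le> real (card G) * \<epsilon> / n"
      using n sum_bounded_above[of G "\<lambda>y. Re (state_ext \<tau> (B y))" \<epsilon>] B(3) by (intro divide_right_mono) (auto simp: less_imp_le)
    also have "\<dots> < \<epsilon>" using n e by (simp add: n_def field_simps)
    finally have 3: "Re (state_ext \<tau> b) < \<epsilon>" .
    have 4: "\<gamma> \<le> Re (state_ext \<sigma> b)" if s: "\<sigma> \<in> states" and y: "y \<in> G" "r \<le> Re (state_ext \<sigma> y)" for \<sigma> y
    proof -
      have S: "positive_functional (state_ext \<sigma>)" using s by (rule state_ext_positive)
      have p: "0 \<le> Re (state_ext \<sigma> (B z))" if "z \<in> G" for z using pf_pos(1)[OF S B(1)[OF that]] .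
      have "norm y \<le> M" unfolding M_def using member_le_sum[OF y(1) _ G(1), of norm] by simp
      then have "2 * norm y * sqrt (Re (state_ext \<sigma> (B y))) \<le> 2 * M * sqrt (Re (state_ext \<sigma> (B y)))"
        using p[OF y(1)] by (intro mult_right_mono) auto
      then have "r / 2 \<le> 2 * M * sqrt (Re (state_ext \<sigma> (B y)))" using B(4)[OF y(1) s] y(2) by simp
      then have "r / (4 * M) \<le> sqrt (Re (state_ext \<sigma> (B y)))" using M by (simp add: field_simps)
      then have "(r / (4 * M))\<^sup>2 \<le> (sqrt (Re (state_ext \<sigma> (B y))))\<^sup>2"
        using r M by (intro power_mono) auto
      also have "\<dots> = Re (state_ext \<sigma> (B y))" using p[OF y(1)] by simp
      also have "\<dots> \<le> (\<Sum>z\<in>G. Re (state_ext \<sigma> (B z)))"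
        using member_le_sum[OF y(1) _ G(1), of "\<lambda>z. Re (state_ext \<sigma> (B z))"] p by simp
      finally show ?thesis
        using n by (simp add: \<gamma>_def b_def pf_scaleR[OF S] pf_sum[OF S G(1)] divide_right_mono)
    qed
    show "\<exists>b. pos b \<and> pos (1 - b) \<and> Re (state_ext \<tau> b) < \<epsilon> \<and>
      (\<forall>\<sigma>\<in>states. (\<exists>y\<in>G. r \<le> Re (state_ext \<sigma> y)) \<longrightarrow> \<gamma> \<le> Re (state_ext \<sigma> b))"
      using 1 2 3 4 by blast
  qed
qed

lemma complex_direction:
  obtains c where "c \<in> {1, -1, \<i>, -\<i>}" "cmod z / 2 \<le> Re (c * z)"
proof -
  have "cmod z / 2 \<le> \<bar>Re z\<bar> \<or> cmod z / 2 \<le> \<bar>Im z\<bar>"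
    using cmod_le[of z] by linarith
  then have "cmod z / 2 \<le> Re (1 * z) \<or> cmod z / 2 \<le> Re (-1 * z) \<or> cmod z / 2 \<le> Re (\<i> * z) \<or> cmod z / 2 \<le> Re (-\<i> * z)"
    by (auto simp: abs_if split: if_splits)
  then show thesis using that by blast
qed

text \<open>A complex number has a modulus at most twice its largest real part after multiplication by one of \<open>1, -1, i, -i\<close>, so
  the distance of \<open>\<sigma> x\<close> from \<open>\<tau> x\<close> is detected by four self-adjoint elements of the unitization
  at which \<open>\<tau>\<close> vanishes.\<close>
lemma excision_neighbourhood:
  fixes \<tau> :: "'a::cstar_algebra \<Rightarrow>\<^sub>L complex"
  assumes t: "\<tau> \<in> pure_states" and F: "finite F" and r: "0 < r"
  obtains \<gamma> where "0 < \<gamma>"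
    "\<And>\<epsilon>. 0 < \<epsilon> \<Longrightarrow> \<exists>b. pos b \<and> pos (1 - b) \<and> Re (state_ext \<tau> b) < \<epsilon> \<and>
      (\<forall>\<sigma>\<in>states. (\<exists>x\<in>F. r \<le> cmod (blinfun_apply \<sigma> x - blinfun_apply \<tau> x)) \<longrightarrow> \<gamma> \<le> Re (state_ext \<sigma> b))"
proof -
  define y where "y x c = real_part (c *\<^sub>C Unitize x (- blinfun_apply \<tau> x))" for x c
  define G where "G = (\<lambda>(x, c). y x c) ` (F \<times> {1, -1, \<i>, -\<i>})"
  have S: "Re (state_ext \<sigma> (y x c)) = Re (c * (blinfun_apply \<sigma> x - blinfun_apply \<tau> x))"
    if "\<sigma> \<in> states" for \<sigma> x c
  proof -
    have S: "positive_functional (state_ext \<sigma>)" using that by (rule state_ext_positive)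
    show ?thesis
      unfolding y_def real_part_def
      by (simp add: pf_scaleR[OF S] pf_add[OF S] pf_star[OF S] pf_scaleC[OF S]) (simp add: state_ext_def)
  qed
  have "finite G" using F by (simp add: G_def)
  moreover have "star z = z \<and> Re (state_ext \<tau> z) \<le> 0" if "z \<in> G" for z
  proof -
    obtain w where w: "z = (case w of (x, c) \<Rightarrow> y x c)" using \<open>z \<in> G\<close> unfolding G_def by blast
    obtain x c where "w = (x, c)" by (cases w)
    then have z: "z = y x c" using w by simp
    show ?thesis using S[OF pure_imp_state[OF t], of x c] unfolding z by (simp add: y_def star_real_part)
  qed
  ultimately obtain \<gamma> where \<gamma>: "0 < \<gamma>"
    "\<And>\<epsilon>. 0 < \<epsilon> \<Longrightarrow> \<exists>b. pos b \<and> pos (1 - b) \<and> Re (state_ext \<tau> b) < \<epsilon> \<and>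
      (\<forall>\<sigma>\<in>states. (\<exists>y\<in>G. r/2 \<le> Re (state_ext \<sigma> y)) \<longrightarrow> \<gamma> \<le> Re (state_ext \<sigma> b))"
    using excision_finite_set[OF t, of G "r/2"] r by (metis half_gt_zero)
  have sep: "\<exists>z\<in>G. r/2 \<le> Re (state_ext \<sigma> z)"
    if s: "\<sigma> \<in> states" and x: "x \<in> F" "r \<le> cmod (blinfun_apply \<sigma> x - blinfun_apply \<tau> x)" for \<sigma> x
  proof -
    obtain c where c: "c \<in> {1, -1, \<i>, -\<i>}"
      "cmod (blinfun_apply \<sigma> x - blinfun_apply \<tau> x) / 2 \<le> Re (c * (blinfun_apply \<sigma> x - blinfun_apply \<tau> x))"
      by (rule complex_direction)
    then have "y x c \<in> G" using x by (force simp: G_def)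
    moreover have "r / 2 \<le> Re (state_ext \<sigma> (y x c))" using c(2) x(2) S[OF s] by simp
    ultimately show ?thesis by blast
  qed
  show thesis
    by (rule that[OF \<gamma>(1)]) (use \<gamma>(2) sep in meson)
qed

text \<open>The complement \<open>g = 1 - b\<close> has the right values but lies in the unitization; \<open>a = g E g\<close>, where \<open>E\<close> is the square of a
  member of an approximate unit, lies in the algebra, is dominated by \<open>g\<close>, and costs little at \<open>\<tau>\<close>.\<close>
lemma excision_in_algebra:
  fixes \<tau> :: "'a::cstar_algebra \<Rightarrow>\<^sub>L complex"
  assumes t: "\<tau> \<in> states" and b: "pos b" "pos (1 - b)" "Re (state_ext \<tau> b) \<le> \<epsilon>" and e: "0 < \<epsilon>"
  obtains a where "pos (Unitize a 0)" "pos (1 - Unitize a 0)"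
    "1 - \<epsilon> - 2 * sqrt \<epsilon> \<le> Re (blinfun_apply \<tau> a)"
    "\<And>\<sigma>. \<sigma> \<in> states \<Longrightarrow> Re (blinfun_apply \<sigma> a) \<le> 1 - Re (state_ext \<sigma> b)"
proof -
  have T: "positive_functional (state_ext \<tau>)" using t by (rule state_ext_positive)
  obtain e where e: "star e = e" "norm e \<le> 1" "1 - \<epsilon> \<le> Re (blinfun_apply \<tau> (e * e))"
    using state_approximate_unit[OF t e] by metis
  define E where "E = Unitize (e * e) 0"
  have sE: "star E = E" by (intro unitization_eqI) (simp_all add: E_def star_mult e)
  have "norm (e * e) \<le> 1" using norm_mult_ineq[of e e] mult_le_one[OF e(2) norm_ge_zero e(2)] by linarith
  then have nE: "norm E \<le> 1" by (simp add: E_def norm_Unitize_0)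
  have E1: "pos (1 - E)" using pos_norm_diff[OF sE nE] by simp
  have "E = Unitize e 0 * Unitize e 0" by (intro unitization_eqI) (simp_all add: E_def)
  moreover have "star (Unitize e 0) = Unitize e 0" by (intro unitization_eqI) (simp_all add: e)
  ultimately have E0: "pos E" using pos_squareI by metis
  define g where "g = 1 - b"
  have sg: "star g = g" using b(2) by (simp add: g_def pos_sa)
  define a where "a = alg (g * E * g)"
  have a: "Unitize a 0 = g * E * g" by (intro unitization_eqI) (simp_all add: a_def E_def)
  have p: "pos (Unitize a 0)" unfolding a using pos_conj[OF E0, of g] by (simp add: sg)
  have gE: "pos (g * g - Unitize a 0)"
    unfolding a using pos_conj[OF E1, of g] by (simp add: sg algebra_simps)
  have gg: "pos (g - g * g)" using b by (intro pos_diff_square) (simp_all add: g_def)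
  have ga: "pos (g - Unitize a 0)" using pos_add[OF gE gg] by simp
  have "pos (1 - Unitize a 0)" using pos_add[OF ga b(1)] by (simp add: g_def)
  moreover have "1 - \<epsilon> - 2 * sqrt \<epsilon> \<le> Re (blinfun_apply \<tau> a)"
  proof -
    have bnd: "norm u * sqrt \<epsilon> \<le> sqrt \<epsilon>" if "norm u \<le> 1" for u :: "'a unitization"
      using mult_right_mono[OF that, of "sqrt \<epsilon>"] \<open>0 < \<epsilon>\<close> by simp
    have ng: "norm g \<le> 1" using b by (intro norm_le_one) (simp_all add: g_def)
    have "norm (g * E) \<le> 1"
      using norm_mult_ineq[of g E] mult_le_one[OF ng norm_ge_zero nE] by linarith
    then have 1: "cmod (state_ext \<tau> ((g * E) * b)) \<le> sqrt \<epsilon>"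
      by (rule order_trans[OF cauchy_schwarz_norm(1)[OF T state_ext_1 b] bnd])
    have 2: "cmod (state_ext \<tau> (b * E)) \<le> sqrt \<epsilon>"
      by (rule order_trans[OF cauchy_schwarz_norm(2)[OF T state_ext_1 b] bnd[OF nE]])
    have "E = Unitize a 0 + b * E + (g * E) * b" unfolding a by (simp add: g_def algebra_simps)
    then have "state_ext \<tau> E = blinfun_apply \<tau> a + state_ext \<tau> (b * E) + state_ext \<tau> ((g * E) * b)"
      by (metis pf_add[OF T] state_ext_Unitize)
    moreover have "state_ext \<tau> E = blinfun_apply \<tau> (e * e)" by (simp add: E_def)
    ultimately show ?thesis
      using e(3) 1 2 complex_Re_le_cmod[of "state_ext \<tau> (b * E)"] complex_Re_le_cmod[of "state_ext \<tau> ((g * E) * b)"]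
      by simp
  qed
  moreover have "Re (blinfun_apply \<sigma> a) \<le> 1 - Re (state_ext \<sigma> b)" if "\<sigma> \<in> states" for \<sigma>
  proof -
    have S: "positive_functional (state_ext \<sigma>)" using that by (rule state_ext_positive)
    show ?thesis using pf_mono[OF S ga] by (simp add: g_def pf_diff[OF S])
  qed
  ultimately show thesis using that[OF p] by blast
qed

text \<open>A self-adjoint square root of an element with scalar part \<open>0\<close> also has scalar part \<open>0\<close>; positivity in the unitization
  thus descends to the algebra.\<close>
lemma pos_scal: assumes "pos z" shows "0 \<le> Re (scal z)" "scal z = 0 \<Longrightarrow> cstar_positive (alg z)"
proof -
  obtain y where y: "star y = y" "y * y = z" using pos_sqrt[OF assms] by metis
  have "cnj (scal y) = scal y" using arg_cong[OF y(1), of scal] by simp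
  then have "Im (scal y) = 0" by (simp add: complex_eq_iff)
  then show "0 \<le> Re (scal z)" by (simp flip: y(2))
  assume "scal z = 0"
  then have "scal y = 0" by (simp flip: y(2))
  moreover have "star (alg y) = alg y" using arg_cong[OF y(1), of alg] by simp
  ultimately have "alg z = star (alg y) * alg y" by (simp flip: y(2))
  then show "cstar_positive (alg z)" unfolding cstar_positive_def by blast
qed

text \<open>In terms of continuous functions of \<open>a\<close>: \<open>d = min (1, a / \<theta>)\<close>, and \<open>c = max (0, a - \<theta>) / (1 - \<theta>)\<close> is
  supported where \<open>d\<close> equals \<open>1\<close>, so \<open>d c = c\<close>. Hence the state \<open>\<tau>' = \<tau> (c \<cdot> c) / \<tau> (c\<^sup>2)\<close> takes the value \<open>1\<close> at
  \<open>d\<close>. As \<open>c \<ge> (a - \<theta>) / (1 - \<theta>)\<close>, the hypothesis on \<open>\<tau> a\<close> makes \<open>\<tau> (1 - c) \<le> q\<close>, and the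
  Cauchy--Schwarz inequality shows that compressing by \<open>c\<close> moves \<open>\<tau>\<close> by at most a multiple of \<open>sqrt q\<close>.\<close>
lemma nearby_state_attaining_one:
  fixes \<tau> :: "'a::cstar_algebra \<Rightarrow>\<^sub>L complex"
  assumes t: "\<tau> \<in> states" and a: "pos (Unitize a 0)" "pos (1 - Unitize a 0)"
    and \<theta>: "0 < \<theta>" "\<theta> < 1" and q: "1 - q * (1 - \<theta>) \<le> Re (blinfun_apply \<tau> a)" "2 * sqrt q < 1" "0 \<le> q"
  obtains d \<tau>' where "cstar_positive d" "norm d \<le> 1" "\<tau>' \<in> states" "blinfun_apply \<tau>' d = 1"
    "\<And>\<sigma>. \<sigma> \<in> states \<Longrightarrow> cmod (blinfun_apply \<sigma> d) \<le> Re (blinfun_apply \<sigma> a) / \<theta>"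
    "\<And>x. cmod (blinfun_apply \<tau>' x - blinfun_apply \<tau> x) \<le> 4 * sqrt q * norm x"
proof -
  define T where "T = state_ext \<tau>"
  have T: "positive_functional T" unfolding T_def using t by (rule state_ext_positive)
  have T1: "T 1 = 1" by (simp add: T_def)
  define r where "r = 1 - \<theta>"
  have r: "0 < r" using \<theta> by (simp add: r_def)
  define A where "A = Unitize a 0"
  define u where "u = 1 - (1/\<theta>) *\<^sub>R A"
  have "star A = A" using a(1) by (simp add: A_def pos_sa)
  then have "star u = u" by (simp add: u_def star_simps)
  then obtain n n' where n: "pos n" "pos n'" "u = n - n'" "n * n' = 0" "n' * n = 0"
    by (rule positive_negative_parts) blast
  have nn: "norm n \<le> 1"
    using a(1) \<theta> by (intro positive_part_le[OF n(1,4,5)]) (auto simp: u_def A_def pos_scaleR simp flip: n(3))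
  have "(1/\<theta> - 1) *\<^sub>R 1 - (n' - n) = (1/\<theta>) *\<^sub>R (1 - A)"
  proof -
    have "n' - n = (1/\<theta>) *\<^sub>R A - 1" using n(3) by (simp add: u_def algebra_simps)
    then show ?thesis by (simp add: algebra_simps)
  qed
  then have "pos ((1/\<theta> - 1) *\<^sub>R 1 - (n' - n))" using a(2) \<theta> by (simp add: A_def pos_scaleR)
  then have nn': "norm n' \<le> 1/\<theta> - 1" using \<theta> by (intro positive_part_le[OF n(2,5,4)]) auto
  define c where "c = (\<theta>/r) *\<^sub>R n'"
  have pc: "pos c" using n(2) \<theta> r by (simp add: c_def pos_scaleR)
  have sc: "star c = c" using pc by (rule pos_sa)
  have "norm c = (\<theta>/r) * norm n'" using \<theta> r by (simp add: c_def)
  also have "\<dots> \<le> (\<theta>/r) * (1/\<theta> - 1)" using \<theta> r nn' by (intro mult_left_mono) auto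
  also have "\<dots> = 1" using \<theta> by (simp add: r_def field_simps)
  finally have nc: "norm c \<le> 1" .
  have pc1: "pos (1 - c)" using pos_norm_diff[OF sc nc] by simp
  have Tc: "Re (T (1 - c)) \<le> q"
  proof -
    have "c - (\<theta>/r) *\<^sub>R (- u) = (\<theta>/r) *\<^sub>R n" by (simp add: c_def n(3) algebra_simps)
    then have "pos (c - (\<theta>/r) *\<^sub>R (- u))" using n(1) \<theta> r by (simp add: pos_scaleR)
    from pf_mono[OF T this] have "(\<theta>/r) * (Re (T A) / \<theta> - 1) \<le> Re (T c)"
      by (simp add: u_def pf_scaleR[OF T] pf_minus[OF T] pf_diff[OF T] T1)
    moreover have "(\<theta>/r) * (Re (T A) / \<theta> - 1) = 1 - (1 - Re (T A)) / r"
      using \<theta> r by (simp add: field_simps r_def)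
    moreover have "(1 - Re (T A)) / r \<le> q"
      using q(1) r by (simp add: T_def A_def r_def field_simps)
    ultimately show ?thesis by (simp add: pf_diff[OF T] T1)
  qed
  have close: "cmod (T (c * x * c) - T x) \<le> 2 * sqrt q * norm x" for x
  proof -
    have "c * x * c - x = - ((1 - c) * x + (c * x) * (1 - c))" by (simp add: algebra_simps)
    then have "T (c * x * c) - T x = - (T ((1 - c) * x) + T ((c * x) * (1 - c)))"
      by (metis pf_minus[OF T] pf_add[OF T] pf_diff[OF T])
    then have "cmod (T (c * x * c) - T x) \<le> cmod (T ((1 - c) * x)) + cmod (T ((c * x) * (1 - c)))"
      by (metis norm_minus_cancel norm_triangle_ineq)
    moreover have "cmod (T ((1 - c) * x)) \<le> norm x * sqrt q"
      using pc by (intro cauchy_schwarz_norm(2)[OF T T1 pc1 _ Tc]) simp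
    moreover have "cmod (T ((c * x) * (1 - c))) \<le> norm (c * x) * sqrt q"
      using pc by (intro cauchy_schwarz_norm(1)[OF T T1 pc1 _ Tc]) simp
    moreover have "norm (c * x) * sqrt q \<le> norm x * sqrt q"
      using norm_mult_ineq[of c x] mult_right_mono[OF nc, of "norm x"] q by (intro mult_right_mono) auto
    moreover have "2 * sqrt q * norm x = norm x * sqrt q + norm x * sqrt q" by simp
    ultimately show ?thesis by linarith
  qed
  define N where "N = Re (T (c * c))"
  have TN: "T (c * c) = of_real N"
    using pf_star_mult[OF T, of c] by (simp add: N_def sc complex_nonneg_Reals_iff complex_eq_iff)
  have "cmod (T (c * c) - 1) \<le> 2 * sqrt q * norm (1::'a unitization)" using close[of 1] by (simp add: T1)
  also have "\<dots> \<le> 2 * sqrt q" using norm_1_le[where 'a = "'a unitization"] q by (intro mult_left_le) auto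
  finally have "cmod (of_real (N - 1)) \<le> 2 * sqrt q" by (simp add: TN)
  then have N1: "\<bar>N - 1\<bar> \<le> 2 * sqrt q" by (simp only: norm_of_real)
  then have N: "N > 0" using q by linarith
  define \<phi> where "\<phi> x = T (c * x * c)" for x
  have \<phi>: "positive_functional \<phi>" unfolding \<phi>_def using pf_conj[OF T, of c] by (simp add: sc)
  have \<phi>1: "\<phi> 1 = of_real N" by (simp add: \<phi>_def TN)
  define \<phi>' where "\<phi>' = Blinfun (\<lambda>x. \<phi> (Unitize x 0))"
  have bphi: "cmod (\<phi> z) \<le> N * norm z" for z using pf_norm_le[OF \<phi>, of z] by (simp add: \<phi>1)
  have bl: "bounded_linear (\<lambda>x. \<phi> (Unitize x 0))"
    by (rule bounded_linear_intro[where K = N])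
      (use bphi[of "Unitize _ 0"] in \<open>auto simp: Unitize_0_simps pf_add[OF \<phi>] pf_scaleR[OF \<phi>] scaleR_conv_of_real norm_Unitize_0 mult.commute\<close>)
  have ap: "blinfun_apply \<phi>' x = \<phi> (Unitize x 0)" for x
    by (simp add: \<phi>'_def bounded_linear_Blinfun_apply[OF bl])
  have pphi: "positive_functional (blinfun_apply \<phi>')"
    using pf_add[OF \<phi>] pf_scaleC[OF \<phi>] pf_star_mult[OF \<phi>]
    by (simp add: positive_functional_def ap Unitize_0_simps)
  define D where "D = 1 - n"
  have sn: "star n = n" using n(1) by (rule pos_sa)
  have pD: "pos D" using pos_norm_diff[OF sn nn] by (simp add: D_def)
  have nD: "norm D \<le> 1" using norm_diff_of_pos[OF n(1) nn] by (simp add: D_def)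
  \<comment> \<open>The scalar part is a character with value 1 at \<open>u\<close>; as it is nonnegative at \<open>n\<close> and \<open>n'\<close>, whose product is 0, it is 1 at \<open>n\<close>.\<close>
  have scD: "scal D = 0"
  proof -
    have "scal n - scal n' = 1" using arg_cong[OF n(3), of scal] by (simp add: u_def A_def)
    moreover have "scal n = 0 \<or> scal n' = 0" using arg_cong[OF n(4), of scal] by simp
    moreover have "0 \<le> Re (scal n')" using n(2) by (rule pos_scal)
    ultimately show ?thesis by (auto simp: D_def complex_eq_iff)
  qed
  define d where "d = alg D"
  have Ud: "Unitize d 0 = D" using scD by (intro unitization_eqI) (simp_all add: d_def)
  have nd: "norm d \<le> 1" using nD by (simp flip: Ud add: norm_Unitize_0)
  have "D * c = c" using n(4) by (simp add: D_def c_def left_diff_distrib)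
  then have \<phi>d: "blinfun_apply \<phi>' d = of_real N" by (simp add: ap Ud \<phi>_def mult.assoc TN)
  have "norm \<phi>' = N"
  proof (rule antisym)
    show "norm \<phi>' \<le> N"
      by (rule norm_blinfun_bound) (use N bphi[of "Unitize _ 0"] in \<open>auto simp: ap norm_Unitize_0\<close>)
    have "N \<le> norm \<phi>' * norm d" using norm_blinfun[of \<phi>' d] N by (simp add: \<phi>d)
    also have "\<dots> \<le> norm \<phi>'" using nd by (intro mult_left_le) auto
    finally show "N \<le> norm \<phi>'" .
  qed
  define \<tau>' where "\<tau>' = (1/N) *\<^sub>R \<phi>'"
  have t': "\<tau>' \<in> states" unfolding \<tau>'_def by (rule normalized_state[OF pphi \<open>norm \<phi>' = N\<close> N])
  show thesis
  proof (rule that)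
    show "cstar_positive d" unfolding d_def using pD scD by (rule pos_scal)
    show "norm d \<le> 1" "\<tau>' \<in> states" by (rule nd, rule t')
    show "blinfun_apply \<tau>' d = 1" using N by (simp add: \<tau>'_def blinfun.scaleR_left \<phi>d scaleR_conv_of_real)
    fix \<sigma> :: "'a \<Rightarrow>\<^sub>L complex" assume "\<sigma> \<in> states"
    then have S: "positive_functional (state_ext \<sigma>)" by (rule state_ext_positive)
    have "(1/\<theta>) *\<^sub>R A - D = n'" using n(3) by (simp add: u_def D_def algebra_simps)
    then have "pos ((1/\<theta>) *\<^sub>R A - D)" using n(2) by simp
    from pf_mono[OF S this] have "Re (blinfun_apply \<sigma> d) \<le> Re (blinfun_apply \<sigma> a) / \<theta>"
      by (simp add: pf_scaleR[OF S] A_def flip: Ud)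
    moreover have "cmod (blinfun_apply \<sigma> d) = Re (blinfun_apply \<sigma> d)"
      using pf_pos[OF S pD] by (simp add: cmod_eq_Re flip: Ud)
    ultimately show "cmod (blinfun_apply \<sigma> d) \<le> Re (blinfun_apply \<sigma> a) / \<theta>" by simp
  next
    fix x
    have N\<tau>': "of_real N * blinfun_apply \<tau>' x = \<phi> (Unitize x 0)"
      using N by (simp add: \<tau>'_def blinfun.scaleR_left ap scaleR_conv_of_real)
    have "blinfun_apply \<tau>' x - blinfun_apply \<tau> x =
        (\<phi> (Unitize x 0) - T (Unitize x 0)) - of_real (N - 1) * blinfun_apply \<tau>' x"
      unfolding N\<tau>'[symmetric] by (simp add: T_def algebra_simps)
    then have "cmod (blinfun_apply \<tau>' x - blinfun_apply \<tau> x) \<le>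
        cmod (\<phi> (Unitize x 0) - T (Unitize x 0)) + cmod (of_real (N - 1) * blinfun_apply \<tau>' x)"
      by (metis norm_triangle_ineq4)
    moreover have "cmod (\<phi> (Unitize x 0) - T (Unitize x 0)) \<le> 2 * sqrt q * norm x"
      using close[of "Unitize x 0"] by (simp add: \<phi>_def norm_Unitize_0)
    moreover have "cmod (of_real (N - 1) * blinfun_apply \<tau>' x) \<le> 2 * sqrt q * norm x"
      unfolding norm_mult norm_of_real using N1 state_norm_le[OF t', of x] q by (intro mult_mono) auto
    ultimately show "cmod (blinfun_apply \<tau>' x - blinfun_apply \<tau> x) \<le> 4 * sqrt q * norm x" by simp
  qed
qed

section \<open>Discrete sets of pure states\<close>

text \<open>The topology of pointwise convergence is a product topology, whose basic open sets restrict
  finitely many coordinates.\<close>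
lemma discrete_separation:
  fixes D :: "('a::cstar_algebra \<Rightarrow>\<^sub>L complex) set"
  assumes D: "D \<subseteq> pure_states" "discrete_in pure_state_space D" and t: "\<tau> \<in> D"
  obtains F r where "finite F" "0 < r"
    "\<And>\<sigma>. \<sigma> \<in> D \<Longrightarrow> \<sigma> \<noteq> \<tau> \<Longrightarrow> \<exists>x\<in>F. r \<le> cmod (blinfun_apply \<sigma> x - blinfun_apply \<tau> x)"
proof -
  have "openin (subtopology pure_state_space D) {\<tau>}"
    using D(2) t by (simp add: discrete_in_def)
  then obtain W where W: "openin strong_operator_topology W" "{\<tau>} = W \<inter> pure_states \<inter> D"
    unfolding pure_state_space_def openin_subtopology by blast
  obtain V where V: "open V" "W = blinfun_apply -` V"
    using W(1) unfolding strong_operator_topology_def openin_pullback_topology by auto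
  have "openin (product_topology (\<lambda>x::'a. euclidean :: complex topology) UNIV) V"
    using V(1) by (simp add: euclidean_product_topology)
  moreover have "blinfun_apply \<tau> \<in> V" using W(2) V(2) by auto
  ultimately obtain X where X: "blinfun_apply \<tau> \<in> (\<Pi>\<^sub>E i\<in>UNIV. X i)" "\<And>i. open (X i)"
      "finite {i. X i \<noteq> UNIV}" "(\<Pi>\<^sub>E i\<in>UNIV. X i) \<subseteq> V"
    using product_topology_open_contains_basis[of "\<lambda>x::'a. euclidean :: complex topology" UNIV V "blinfun_apply \<tau>"] by auto
  define F where "F = {i. X i \<noteq> UNIV}"
  have "\<forall>i\<in>F. \<exists>e>0. ball (blinfun_apply \<tau> i) e \<subseteq> X i"
    using X(1,2) open_contains_ball by (fastforce simp: PiE_iff)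
  then obtain e where e: "\<And>i. i \<in> F \<Longrightarrow> 0 < e i \<and> ball (blinfun_apply \<tau> i) (e i) \<subseteq> X i" by metis
  define r where "r = Min (insert 1 (e ` F))"
  have F: "finite F" using X(3) by (simp add: F_def)
  have r: "0 < r" unfolding r_def using F e by (subst Min_gr_iff) auto
  have re: "r \<le> e i" if "i \<in> F" for i unfolding r_def using F that by (intro Min_le) auto
  show thesis
  proof (rule that[OF F r], rule ccontr)
    fix \<sigma> assume s: "\<sigma> \<in> D" "\<sigma> \<noteq> \<tau>" and "\<not> (\<exists>x\<in>F. r \<le> cmod (blinfun_apply \<sigma> x - blinfun_apply \<tau> x))"
    then have "blinfun_apply \<sigma> i \<in> ball (blinfun_apply \<tau> i) (e i)" if "i \<in> F" for i
      using re[OF that] that by (force simp: dist_norm norm_minus_commute)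
    then have "blinfun_apply \<sigma> i \<in> X i" if "i \<in> F" for i using e[OF that] that by blast
    then have "blinfun_apply \<sigma> i \<in> X i" for i by (cases "i \<in> F") (auto simp: F_def)
    then have "\<sigma> \<in> W" using X(4) V(2) by (auto simp: PiE_iff)
    then show False using W(2) s D(1) by auto
  qed
qed

text \<open>The order of the quantifiers matters: one \<open>\<gamma>\<close> has to work for all \<open>\<epsilon>\<close>, so that \<open>\<epsilon>\<close> can be chosen once
  a common \<open>\<gamma>\<close> for uncountably many states has been found.\<close>
definition excised_with_gap ::
    "('a::cstar_algebra \<Rightarrow>\<^sub>L complex) set \<Rightarrow> real \<Rightarrow> ('a \<Rightarrow>\<^sub>L complex) \<Rightarrow> bool"
  where "excised_with_gap D \<gamma> \<tau> \<longleftrightarrow> (\<forall>\<epsilon>>0. \<exists>a. pos (Unitize a 0) \<and> pos (1 - Unitize a 0) \<and>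
    1 - \<epsilon> \<le> Re (blinfun_apply \<tau> a) \<and> (\<forall>\<sigma>\<in>D - {\<tau>}. Re (blinfun_apply \<sigma> a) \<le> 1 - \<gamma>))"

lemma excised_with_gap_mono: "excised_with_gap D \<gamma> \<tau> \<Longrightarrow> \<gamma>' \<le> \<gamma> \<Longrightarrow> excised_with_gap D \<gamma>' \<tau>"
  unfolding excised_with_gap_def by (meson diff_left_mono order_trans)

lemma excised_with_gap_exists:
  assumes D: "D \<subseteq> pure_states" "discrete_in pure_state_space D" and t: "\<tau> \<in> D"
  shows "\<exists>\<gamma>>0. excised_with_gap D \<gamma> \<tau>"
proof -
  have tp: "\<tau> \<in> pure_states" using D t by auto
  then have ts: "\<tau> \<in> states" by (rule pure_imp_state)
  obtain F r where F: "finite F" "0 < r"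
    "\<And>\<sigma>. \<sigma> \<in> D \<Longrightarrow> \<sigma> \<noteq> \<tau> \<Longrightarrow> \<exists>x\<in>F. r \<le> cmod (blinfun_apply \<sigma> x - blinfun_apply \<tau> x)"
    using discrete_separation[OF D t] by metis
  obtain \<gamma> where \<gamma>: "0 < \<gamma>"
    "\<And>\<epsilon>. 0 < \<epsilon> \<Longrightarrow> \<exists>b. pos b \<and> pos (1 - b) \<and> Re (state_ext \<tau> b) < \<epsilon> \<and>
      (\<forall>\<sigma>\<in>states. (\<exists>x\<in>F. r \<le> cmod (blinfun_apply \<sigma> x - blinfun_apply \<tau> x)) \<longrightarrow> \<gamma> \<le> Re (state_ext \<sigma> b))"
    using excision_neighbourhood[OF tp F(1,2)] by metis
  have "\<exists>a. pos (Unitize a 0) \<and> pos (1 - Unitize a 0) \<and>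
    1 - \<epsilon> \<le> Re (blinfun_apply \<tau> a) \<and> (\<forall>\<sigma>\<in>D - {\<tau>}. Re (blinfun_apply \<sigma> a) \<le> 1 - \<gamma>)" if "0 < \<epsilon>" for \<epsilon>
  proof -
    \<comment> \<open>Small enough that the loss \<open>s\<^sup>2 + 2 s\<close> in the passage to the algebra is at most \<open>\<epsilon>\<close>.\<close>
    define s where "s = min \<epsilon> 1 / 3"
    have s: "0 < s" "3 * s \<le> \<epsilon>" "s \<le> 1" using that by (auto simp: s_def)
    obtain b where b: "pos b" "pos (1 - b)" "Re (state_ext \<tau> b) < s\<^sup>2"
      "\<forall>\<sigma>\<in>states. (\<exists>x\<in>F. r \<le> cmod (blinfun_apply \<sigma> x - blinfun_apply \<tau> x)) \<longrightarrow> \<gamma> \<le> Re (state_ext \<sigma> b)"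
      using \<gamma>(2)[of "s\<^sup>2"] s by auto
    obtain a where a: "pos (Unitize a 0)" "pos (1 - Unitize a 0)"
      "1 - s\<^sup>2 - 2 * sqrt (s\<^sup>2) \<le> Re (blinfun_apply \<tau> a)"
      "\<And>\<sigma>. \<sigma> \<in> states \<Longrightarrow> Re (blinfun_apply \<sigma> a) \<le> 1 - Re (state_ext \<sigma> b)"
      using excision_in_algebra[OF ts b(1,2) less_imp_le[OF b(3)]] s by (metis zero_less_power)
    have "s\<^sup>2 \<le> s" using s by (simp add: power2_eq_square mult_left_le)
    moreover have "sqrt (s\<^sup>2) = s" using s by simp
    ultimately have "1 - \<epsilon> \<le> Re (blinfun_apply \<tau> a)" using a(3) s by linarith
    moreover have "Re (blinfun_apply \<sigma> a) \<le> 1 - \<gamma>" if "\<sigma> \<in> D - {\<tau>}" for \<sigma>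
    proof -
      have "\<sigma> \<in> states" using that D(1) pure_imp_state by blast
      moreover have "\<exists>x\<in>F. r \<le> cmod (blinfun_apply \<sigma> x - blinfun_apply \<tau> x)" using that F(3) by blast
      ultimately have "\<gamma> \<le> Re (state_ext \<sigma> b)" using b(4) by blast
      then show ?thesis using a(4)[OF \<open>\<sigma> \<in> states\<close>] by linarith
    qed
    ultimately show ?thesis using a(1,2) by blast
  qed
  then show ?thesis using \<gamma>(1) unfolding excised_with_gap_def by blast
qed

lemma uncountable_contains_omega1:
  includes cardinal_syntax
  fixes D :: "'b set"
  assumes "uncountable D"
  obtains g where "inj_on g omega1" "g ` omega1 \<subseteq> D"
proof -
  have "\<not> |D| \<le>o natLeq"
    using assms by (simp add: countable_card_le_natLeq)
  then have "natLeq <o |D|" using natLeq_Card_order card_of_Card_order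
    by (metis Card_order_iff_ordLeq_card_of card_of_Well_order natLeq_Well_order not_ordLeq_iff_ordLess)
  then have "cardSuc natLeq \<le>o |D|"
    by (rule cardSuc_least[OF natLeq_Card_order card_of_Card_order])
  then have "|omega1| \<le>o |D|"
    using cardSuc_Card_order[OF natLeq_Card_order] card_of_Field_ordIso ordIso_ordLeq_trans by blast
  then show thesis using that by (metis card_of_ordLeq)
qed

theorem mainTheorem3:
  assumes "\<exists>D :: ('a::cstar_algebra \<Rightarrow>\<^sub>L complex) set.
    D \<subseteq> pure_states \<and> uncountable D \<and> discrete_in pure_state_space D"
  shows "\<exists>\<eta>::real. 0 \<le> \<eta> \<and> \<eta> < 1 \<and>
    (\<exists>(a :: nat set \<Rightarrow> 'a) (\<tau> :: nat set \<Rightarrow> 'a \<Rightarrow>\<^sub>L complex). UBABS_plus \<eta> a \<tau>)"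
proof -
  obtain D :: "('a \<Rightarrow>\<^sub>L complex) set" where D: "D \<subseteq> pure_states" "uncountable D" "discrete_in pure_state_space D"
    using assms by blast
  have "D \<subseteq> (\<Union>n. {\<tau>\<in>D. excised_with_gap D (1 / real (Suc n)) \<tau>})"
  proof
    fix \<tau> assume t: "\<tau> \<in> D"
    then obtain \<gamma> where "0 < \<gamma>" "excised_with_gap D \<gamma> \<tau>" using excised_with_gap_exists D by blast
    moreover obtain n where "1 / real (Suc n) < \<gamma>" using nat_approx_posE[OF \<open>0 < \<gamma>\<close>] .
    ultimately have "excised_with_gap D (1 / real (Suc n)) \<tau>"
      using excised_with_gap_mono less_imp_le by blast
    then show "\<tau> \<in> (\<Union>n. {\<tau>\<in>D. excised_with_gap D (1 / real (Suc n)) \<tau>})" using t by blast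
  qed
  then obtain n where n: "uncountable {\<tau>\<in>D. excised_with_gap D (1 / real (Suc n)) \<tau>}"
    using D(2) by (meson countable_UN countable_subset uncountable_def countableI_type)
  define \<gamma> where "\<gamma> = 1 / real (Suc n)"
  have \<gamma>: "0 < \<gamma>" "\<gamma> \<le> 1" by (simp_all add: \<gamma>_def)
  define D0 where "D0 = {\<tau>\<in>D. excised_with_gap D \<gamma> \<tau>}"
  \<comment> \<open>Truncation at \<open>\<theta>\<close> raises the bound \<open>1 - \<gamma>\<close> to at most \<open>1 - \<gamma>/2\<close>; moving the states by \<open>4 sqrt q = \<gamma>/4\<close> raises it to at most \<open>1 - \<gamma>/4\<close>.\<close>
  define \<theta> q where "\<theta> = 1 - \<gamma>/4" and "q = (\<gamma>/16)\<^sup>2"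
  have sq: "sqrt q = \<gamma>/16" using \<gamma> by (simp add: q_def)
  have "\<exists>d \<tau>'. cstar_positive d \<and> norm d \<le> 1 \<and> \<tau>' \<in> states \<and> blinfun_apply \<tau>' d = 1 \<and>
      (\<forall>\<sigma>\<in>D - {\<tau>}. cmod (blinfun_apply \<sigma> d) \<le> 1 - \<gamma>/2) \<and>
      (\<forall>x. cmod (blinfun_apply \<tau>' x - blinfun_apply \<tau> x) \<le> \<gamma>/4 * norm x)" if t: "\<tau> \<in> D0" for \<tau>
  proof -
    have ts: "\<tau> \<in> states" using t D(1) pure_imp_state by (auto simp: D0_def)
    have "0 < q * (1 - \<theta>)" using \<gamma> by (simp add: q_def \<theta>_def)
    then obtain a where a: "pos (Unitize a 0)" "pos (1 - Unitize a 0)"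
      "1 - q * (1 - \<theta>) \<le> Re (blinfun_apply \<tau> a)" "\<forall>\<sigma>\<in>D - {\<tau>}. Re (blinfun_apply \<sigma> a) \<le> 1 - \<gamma>"
      using t unfolding D0_def excised_with_gap_def by blast
    have \<theta>: "0 < \<theta>" "\<theta> < 1" and q: "2 * sqrt q < 1" "0 \<le> q"
      using \<gamma> unfolding sq by (simp_all add: \<theta>_def q_def)
    obtain d \<tau>' where d: "cstar_positive d" "norm d \<le> 1" "\<tau>' \<in> states" "blinfun_apply \<tau>' d = 1"
      "\<And>\<sigma>. \<sigma> \<in> states \<Longrightarrow> cmod (blinfun_apply \<sigma> d) \<le> Re (blinfun_apply \<sigma> a) / \<theta>"
      "\<And>x. cmod (blinfun_apply \<tau>' x - blinfun_apply \<tau> x) \<le> 4 * sqrt q * norm x"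
      using nearby_state_attaining_one[OF ts a(1,2) \<theta> a(3) q] by metis
    have "cmod (blinfun_apply \<sigma> d) \<le> 1 - \<gamma>/2" if s: "\<sigma> \<in> D - {\<tau>}" for \<sigma>
    proof -
      have "1 - \<gamma> \<le> (1 - \<gamma>/2) * \<theta>" using \<gamma> by (simp add: \<theta>_def algebra_simps)
      then have "Re (blinfun_apply \<sigma> a) / \<theta> \<le> 1 - \<gamma>/2"
        using a(4)[rule_format, OF s] \<theta> by (simp add: divide_le_eq)
      moreover have "\<sigma> \<in> states" using s D(1) pure_imp_state by blast
      ultimately show ?thesis using d(5) by force
    qed
    then show ?thesis using d by (auto simp: sq)
  qed
  then obtain d T where d: "\<And>\<tau>. \<tau> \<in> D0 \<Longrightarrow> cstar_positive (d \<tau>) \<and> norm (d \<tau>) \<le> 1 \<and> T \<tau> \<in> states \<and>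
      blinfun_apply (T \<tau>) (d \<tau>) = 1"
    and other: "\<And>\<tau> \<sigma>. \<tau> \<in> D0 \<Longrightarrow> \<sigma> \<in> D - {\<tau>} \<Longrightarrow> cmod (blinfun_apply \<sigma> (d \<tau>)) \<le> 1 - \<gamma>/2"
    and near: "\<And>\<tau> x. \<tau> \<in> D0 \<Longrightarrow> cmod (blinfun_apply (T \<tau>) x - blinfun_apply \<tau> x) \<le> \<gamma>/4 * norm x"
    by metis
  obtain g where g: "inj_on g omega1" "g ` omega1 \<subseteq> D0"
    using uncountable_contains_omega1[OF n] unfolding D0_def \<gamma>_def by metis
  have "UBABS_plus (1 - \<gamma>/4) (\<lambda>\<alpha>. d (g \<alpha>)) (\<lambda>\<alpha>. T (g \<alpha>))"
    unfolding UBABS_plus_def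
  proof (intro conjI ballI impI)
    show "bounded ((\<lambda>\<alpha>. (d (g \<alpha>), T (g \<alpha>))) ` omega1)"
    proof (rule boundedI)
      fix z assume "z \<in> (\<lambda>\<alpha>. (d (g \<alpha>), T (g \<alpha>))) ` omega1"
      then obtain \<tau> where "\<tau> \<in> D0" "z = (d \<tau>, T \<tau>)" using g(2) by auto
      moreover from this have "norm (d \<tau>) \<le> 1" "norm (T \<tau>) = 1"
        using d[of \<tau>] by (auto simp: states_def)
      moreover have "norm (d \<tau>, T \<tau>) \<le> norm (d \<tau>) + norm (T \<tau>)" by (rule norm_Pair_le)
      ultimately show "norm z \<le> 2" by simp
    qed
    fix \<alpha> :: "nat set" assume "\<alpha> \<in> omega1"
    then have ga: "g \<alpha> \<in> D0" using g(2) by auto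
    show "T (g \<alpha>) \<in> states" "cstar_positive (d (g \<alpha>))" "norm (d (g \<alpha>)) \<le> 1"
      "blinfun_apply (T (g \<alpha>)) (d (g \<alpha>)) = 1" using d[OF ga] by auto
    then show "d (g \<alpha>) \<noteq> 0" by (auto simp: blinfun.zero_right)
    fix \<beta> :: "nat set" assume b: "\<beta> \<in> omega1" "\<beta> \<noteq> \<alpha>"
    then have gb: "g \<beta> \<in> D0" "g \<beta> \<noteq> g \<alpha>" using g \<open>\<alpha> \<in> omega1\<close> by (auto dest: inj_onD)
    have "g \<alpha> \<in> D - {g \<beta>}" using ga gb(2) by (auto simp: D0_def)
    then have 1: "cmod (blinfun_apply (g \<alpha>) (d (g \<beta>))) \<le> 1 - \<gamma>/2" by (rule other[OF gb(1)])
    have "\<gamma>/4 * norm (d (g \<beta>)) \<le> \<gamma>/4" using d[OF gb(1)] \<gamma> by (intro mult_left_le) auto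
    then have "cmod (blinfun_apply (T (g \<alpha>)) (d (g \<beta>)) - blinfun_apply (g \<alpha>) (d (g \<beta>))) \<le> \<gamma>/4"
      by (rule order_trans[OF near[OF ga]])
    then show "cmod (blinfun_apply (T (g \<alpha>)) (d (g \<beta>))) \<le> 1 - \<gamma>/4"
      using 1 norm_triangle_sub[of "blinfun_apply (T (g \<alpha>)) (d (g \<beta>))" "blinfun_apply (g \<alpha>) (d (g \<beta>))"]
      by linarith
  qed
  then show ?thesis using \<gamma> by (intro exI[of _ "1 - \<gamma>/4"]) auto
qed

end
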